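(* Consider a motion of a spinning test body with mass $m>0$ and spin magnitude $c>0$ in the Schwarzschild metric outside the horizon, satisfying the Mathisson–Papapetrou–Dixon equations, the Tulczyjew condition and the parametrization $k=m$ (see context), for which the total angular momentum vanishes, $\vec Q=0$. Then $P_\theta=0$, $L_1=0$, $P_\varphi=0$, and the equations of motion are integrable by quadratures. Namely, put $$N(r)=r^4\big(m^2r^2-c^2a(r)\big)\mathcal E^2-a(r)(m^2r^3-\mu c^2)^2,\qquad \eta(r)=m^2r^3-\mu c^2-\frac{3\mu c^4r^4\mathcal E^2}{(m^2r^3-\mu c^2)^2},$$ $$\Phi(r)=-c\,\mathcal E\, r\,\frac{m^2r^3+2\mu c^2}{m^2r^3-\mu c^2},$$ where $\mathcal E=-P_t$ is the conserved energy, and assume $\mathcal E\,(m^2r^3-\mu c^2)>0$, $\eta(r)\ne0$ and $\vec L\neq0$ along the motion. Then $P_r=\pm\dfrac{m\sqrt{N(r)}}{a(r)(m^2r^3-\mu c^2)}$ and, with the same sign, $$\frac{dr}{d\tau}=\pm\frac{\sqrt{N(r)}}{\eta(r)}.$$ Moreover $K=\dfrac{L_2\sin\theta}{\sqrt{L_2^2+L_3^2}}$ is a constant of the motion; if $\kappa$ is its value, with $|\kappa|<1$, then $$\frac{d\theta}{d\tau}=\pm\frac{\Phi(r)}{\eta(r)}\sqrt{1-\frac{\kappa^2}{\sin^2\theta}},\qquad \frac{d\varphi}{d\tau}=-\frac{\kappa\,\Phi(r)}{\eta(r)\sin^2\theta},\qquad \frac{dt}{d\tau}=\frac{m\,r^3\mathcal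 E}{a(r)\,\eta(r)},$$ where in the equation for $\theta$ the upper sign is taken when $L_3>0$ and the lower sign when $L_3<0$.
   Context: Schwarzschild metric, coordinates $y^\alpha=(t,r,\theta,\varphi)$, $r>2\mu$: $ds^2=-a\,dt^2+a^{-1}dr^2+r^2(d\theta^2+\sin^2\theta\,d\varphi^2)$, $a=a(r)=1-2\mu/r$, $\mu>0$; motions are considered where $\sin\theta\neq0$. Curvature convention $[\nabla_\alpha,\nabla_\beta]A^\mu=R^\mu{}_{\nu\alpha\beta}A^\nu$. Mathisson–Papapetrou–Dixon equations for the world line $y^\alpha(\tau)$ ($u^\alpha=dy^\alpha/d\tau$), momentum $p^\alpha$ and antisymmetric spin tensor $S^{\alpha\beta}$: $$\frac{Dp^\alpha}{d\tau}=-\tfrac12R^\alpha{}_{\lambda\mu\nu}u^\lambda S^{\mu\nu},\qquad \frac{DS^{\alpha\beta}}{d\tau}=p^\alpha u^\beta-u^\alpha p^\beta .$$ Tulczyjew condition: $S^{\alpha\beta}p_\beta=0$. Mass and spin: $m^2=-p_\alpha p^\alpha$, $c^2=\frac12S_{\alpha\beta}S^{\alpha\beta}$ (constants). Parametrization: $k:=-p^\alpha u_\alpha=m$. Under the Tulczyjew condition and when $d\ne2m^2$, this is equivalent to $u^\alpha=\frac1m\big(p^\alpha+\frac{\mathcal D^\alpha{}_\beta p^\beta}{2m^2-d}\big)$, with $\mathcal D^\alpha{}_\beta=S^{\alpha\gamma}R_{\gamma\beta\mu\nu}S^{\mu\nu}$, $d=\frac12\mathcal D^\alpha{}_\alpha$;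 it is assumed throughout that $d\neq 2m^2$. Tetrad: $e_0=a^{-1/2}\partial_t$, $e_1=a^{1/2}\partial_r$, $e_2=r^{-1}\partial_\theta$, $e_3=(r\sin\theta)^{-1}\partial_\varphi$. Writing $S^{\alpha\beta}=S^{AB}e_A{}^\alpha e_B{}^\beta$, put $\vec M=(S^{01},S^{02},S^{03})$, $\vec L=(S^{23},S^{31},S^{12})$. The variables $P_\alpha$ are defined by $p_t=P_t-\frac{\mu}{r^2}M_1$, $p_r=P_r$, $p_\theta=P_\theta-\sqrt a\,L_3$, $p_\varphi=P_\varphi+\sqrt a\sin\theta\,L_2-\cos\theta\,L_1$. The energy $\mathcal E=-P_t$ and total angular momentum $\vec Q=(Q_1,Q_2,P_\varphi)$ are conserved, where $$Q_1=\frac{\cos\varphi}{\sin\theta}(L_1-P_\varphi\cos\theta)-P_\theta\sin\varphi,\qquad Q_2=\frac{\sin\varphi}{\sin\theta}(L_1-P_\varphi\cos\theta)+P_\theta\cos\varphi .$$ *)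

theory Defs
  imports "HOL-Analysis.Analysis"
begin

text \<open>
  Coordinate and tetrad indices range over the type \<^typ>\<open>4\<close>, whose elements are 0, 1, 2, 3
  (in this type 4 = 0). Index 0 is \<open>t\<close>, 1 is \<open>r\<close>, 2 is \<open>\<theta>\<close>, 3 is \<open>\<phi>\<close>.
\<close>

definition partial :: "4 \<Rightarrow> (real^4 \<Rightarrow> real) \<Rightarrow> real^4 \<Rightarrow> real" where
  "partial \<alpha> f y = deriv (\<lambda>s. f (y + s *\<^sub>R axis \<alpha> 1)) 0"

definition christoffel :: "(real^4 \<Rightarrow> real^4^4) \<Rightarrow> real^4 \<Rightarrow> 4 \<Rightarrow> 4 \<Rightarrow> 4 \<Rightarrow> real" where
  "christoffel g y \<alpha> \<beta> \<gamma> =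
     1/2 * (\<Sum>\<sigma>\<in>UNIV. matrix_inv (g y) $ \<alpha> $ \<sigma> *
       (partial \<beta> (\<lambda>z. g z $ \<sigma> $ \<gamma>) y + partial \<gamma> (\<lambda>z. g z $ \<sigma> $ \<beta>) y
        - partial \<sigma> (\<lambda>z. g z $ \<beta> $ \<gamma>) y))"

text \<open>
  \<open>riemann g y \<mu> \<nu> \<alpha> \<beta>\<close> is \<open>R\<^sup>\<mu>\<^sub>\<nu>\<^sub>\<alpha>\<^sub>\<beta>\<close> with the sign fixed by
  \<open>[\<nabla>\<^sub>\<alpha>, \<nabla>\<^sub>\<beta>] A\<^sup>\<mu> = R\<^sup>\<mu>\<^sub>\<nu>\<^sub>\<alpha>\<^sub>\<beta> A\<^sup>\<nu>\<close>.
\<close>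

definition riemann :: "(real^4 \<Rightarrow> real^4^4) \<Rightarrow> real^4 \<Rightarrow> 4 \<Rightarrow> 4 \<Rightarrow> 4 \<Rightarrow> 4 \<Rightarrow> real" where
  "riemann g y \<mu> \<nu> \<alpha> \<beta> =
     partial \<alpha> (\<lambda>z. christoffel g z \<mu> \<beta> \<nu>) y - partial \<beta> (\<lambda>z. christoffel g z \<mu> \<alpha> \<nu>) y
     + (\<Sum>\<rho>\<in>UNIV. christoffel g y \<mu> \<alpha> \<rho> * christoffel g y \<rho> \<beta> \<nu>
                - christoffel g y \<mu> \<beta> \<rho> * christoffel g y \<rho> \<alpha> \<nu>)"

definition riemann_low :: "(real^4 \<Rightarrow> real^4^4) \<Rightarrow> real^4 \<Rightarrow> 4 \<Rightarrow> 4 \<Rightarrow> 4 \<Rightarrow> 4 \<Rightarrow> real" where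
  "riemann_low g y \<gamma> \<beta> \<mu> \<nu> = (\<Sum>\<rho>\<in>UNIV. g y $ \<gamma> $ \<rho> * riemann g y \<rho> \<beta> \<mu> \<nu>)"

definition lower :: "(real^4 \<Rightarrow> real^4^4) \<Rightarrow> real^4 \<Rightarrow> real^4 \<Rightarrow> real^4" where
  "lower g y v = g y *v v"

definition velocity :: "(real \<Rightarrow> real^4) \<Rightarrow> real \<Rightarrow> real^4" where
  "velocity y \<tau> = vector_derivative y (at \<tau>)"

definition cov_deriv_vec ::
  "(real^4 \<Rightarrow> real^4^4) \<Rightarrow> (real \<Rightarrow> real^4) \<Rightarrow> (real \<Rightarrow> real^4) \<Rightarrow> real \<Rightarrow> 4 \<Rightarrow> real" where
  "cov_deriv_vec g y V \<tau> \<alpha> =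
     vector_derivative V (at \<tau>) $ \<alpha>
     + (\<Sum>\<beta>\<in>UNIV. \<Sum>\<gamma>\<in>UNIV. christoffel g (y \<tau>) \<alpha> \<beta> \<gamma> * velocity y \<tau> $ \<beta> * V \<tau> $ \<gamma>)"

definition cov_deriv_tensor ::
  "(real^4 \<Rightarrow> real^4^4) \<Rightarrow> (real \<Rightarrow> real^4) \<Rightarrow> (real \<Rightarrow> real^4^4) \<Rightarrow> real \<Rightarrow> 4 \<Rightarrow> 4 \<Rightarrow> real" where
  "cov_deriv_tensor g y S \<tau> \<alpha> \<beta> =
     vector_derivative S (at \<tau>) $ \<alpha> $ \<beta>
     + (\<Sum>\<gamma>\<in>UNIV. \<Sum>\<delta>\<in>UNIV.
          christoffel g (y \<tau>) \<alpha> \<gamma> \<delta> * velocity y \<tau> $ \<gamma> * S \<tau> $ \<delta> $ \<beta>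
        + christoffel g (y \<tau>) \<beta> \<gamma> \<delta> * velocity y \<tau> $ \<gamma> * S \<tau> $ \<alpha> $ \<delta>)"

text \<open>The components of \<open>p\<close> and \<open>S\<close> are contravariant coordinate components.\<close>

definition mpd_motion ::
  "(real^4 \<Rightarrow> real^4^4) \<Rightarrow> real set \<Rightarrow> (real \<Rightarrow> real^4) \<Rightarrow> (real \<Rightarrow> real^4) \<Rightarrow> (real \<Rightarrow> real^4^4) \<Rightarrow> bool"
where
  "mpd_motion g I y p S \<longleftrightarrow>
     (\<forall>\<tau>\<in>I. y differentiable (at \<tau>) \<and> p differentiable (at \<tau>) \<and> S differentiable (at \<tau>)
       \<and> (\<forall>\<alpha> \<beta>. S \<tau> $ \<beta> $ \<alpha> = - S \<tau> $ \<alpha> $ \<beta>)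
       \<and> (\<forall>\<alpha>. cov_deriv_vec g y p \<tau> \<alpha> =
            - 1/2 * (\<Sum>\<rho>\<in>UNIV. \<Sum>\<mu>\<in>UNIV. \<Sum>\<nu>\<in>UNIV.
                riemann g (y \<tau>) \<alpha> \<rho> \<mu> \<nu> * velocity y \<tau> $ \<rho> * S \<tau> $ \<mu> $ \<nu>))
       \<and> (\<forall>\<alpha> \<beta>. cov_deriv_tensor g y S \<tau> \<alpha> \<beta> =
            p \<tau> $ \<alpha> * velocity y \<tau> $ \<beta> - velocity y \<tau> $ \<alpha> * p \<tau> $ \<beta>))"

definition tulczyjew :: "(real^4 \<Rightarrow> real^4^4) \<Rightarrow> real^4 \<Rightarrow> real^4 \<Rightarrow> real^4^4 \<Rightarrow> bool" where
  "tulczyjew g y p S \<longleftrightarrow> (\<forall>\<alpha>. (\<Sum>\<beta>\<in>UNIV. S $ \<alpha> $ \<beta> * lower g y p $ \<beta>) = 0)"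

definition mass_sq :: "(real^4 \<Rightarrow> real^4^4) \<Rightarrow> real^4 \<Rightarrow> real^4 \<Rightarrow> real" where
  "mass_sq g y p = - (\<Sum>\<alpha>\<in>UNIV. lower g y p $ \<alpha> * p $ \<alpha>)"

definition spin_sq :: "(real^4 \<Rightarrow> real^4^4) \<Rightarrow> real^4 \<Rightarrow> real^4^4 \<Rightarrow> real" where
  "spin_sq g y S =
     1/2 * (\<Sum>\<alpha>\<in>UNIV. \<Sum>\<beta>\<in>UNIV. \<Sum>\<gamma>\<in>UNIV. \<Sum>\<delta>\<in>UNIV.
       g y $ \<alpha> $ \<gamma> * g y $ \<beta> $ \<delta> * S $ \<gamma> $ \<delta> * S $ \<alpha> $ \<beta>)"

definition kinetic_mass :: "(real^4 \<Rightarrow> real^4^4) \<Rightarrow> real^4 \<Rightarrow> real^4 \<Rightarrow> real^4 \<Rightarrow> real" where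
  "kinetic_mass g y p u = - (\<Sum>\<alpha>\<in>UNIV. p $ \<alpha> * lower g y u $ \<alpha>)"

definition D_tensor :: "(real^4 \<Rightarrow> real^4^4) \<Rightarrow> real^4 \<Rightarrow> real^4^4 \<Rightarrow> 4 \<Rightarrow> 4 \<Rightarrow> real" where
  "D_tensor g y S \<alpha> \<beta> =
     (\<Sum>\<gamma>\<in>UNIV. \<Sum>\<mu>\<in>UNIV. \<Sum>\<nu>\<in>UNIV. S $ \<alpha> $ \<gamma> * riemann_low g y \<gamma> \<beta> \<mu> \<nu> * S $ \<mu> $ \<nu>)"

definition d_scalar :: "(real^4 \<Rightarrow> real^4^4) \<Rightarrow> real^4 \<Rightarrow> real^4^4 \<Rightarrow> real" where
  "d_scalar g y S = 1/2 * (\<Sum>\<alpha>\<in>UNIV. D_tensor g y S \<alpha> \<alpha>)"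

definition schw_a :: "real \<Rightarrow> real \<Rightarrow> real" where
  "schw_a \<mu> r = 1 - 2 * \<mu> / r"

definition schwarzschild :: "real \<Rightarrow> real^4 \<Rightarrow> real^4^4" where
  "schwarzschild \<mu> y = (\<chi> \<alpha> \<beta>.
     if \<alpha> \<noteq> \<beta> then 0
     else if \<alpha> = 0 then - schw_a \<mu> (y $ 1)
     else if \<alpha> = 1 then 1 / schw_a \<mu> (y $ 1)
     else if \<alpha> = 2 then (y $ 1)\<^sup>2
     else (y $ 1)\<^sup>2 * (sin (y $ 2))\<^sup>2)"

text \<open>Row \<open>A\<close> of \<open>tetrad \<mu> y\<close> holds the coordinate components of the vector \<open>e\<^sub>A\<close>.\<close>

definition tetrad :: "real \<Rightarrow> real^4 \<Rightarrow> real^4^4" where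
  "tetrad \<mu> y = (\<chi> A \<alpha>.
     if A \<noteq> \<alpha> then 0
     else if A = 0 then 1 / sqrt (schw_a \<mu> (y $ 1))
     else if A = 1 then sqrt (schw_a \<mu> (y $ 1))
     else if A = 2 then 1 / y $ 1
     else 1 / (y $ 1 * sin (y $ 2)))"

text \<open>
  In matrix form, \<open>S\<^sup>\<alpha>\<^sup>\<beta> = S\<^sup>A\<^sup>B e\<^sub>A\<^sup>\<alpha> e\<^sub>B\<^sup>\<beta>\<close> reads \<open>S = e\<^sup>T S' e\<close>, where \<open>S'\<close> is the matrix of
  tetrad components; \<open>tetrad_spin\<close> solves this for \<open>S'\<close>. See \<open>tetrad_spin_expansion\<close> below.
\<close>

definition tetrad_spin :: "real \<Rightarrow> real^4 \<Rightarrow> real^4^4 \<Rightarrow> real^4^4" where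
  "tetrad_spin \<mu> y S = transpose (matrix_inv (tetrad \<mu> y)) ** S ** matrix_inv (tetrad \<mu> y)"

definition M_vec :: "real \<Rightarrow> real^4 \<Rightarrow> real^4^4 \<Rightarrow> real^3" where
  "M_vec \<mu> y S = (let T = tetrad_spin \<mu> y S in vector [T $ 0 $ 1, T $ 0 $ 2, T $ 0 $ 3])"

definition L_vec :: "real \<Rightarrow> real^4 \<Rightarrow> real^4^4 \<Rightarrow> real^3" where
  "L_vec \<mu> y S = (let T = tetrad_spin \<mu> y S in vector [T $ 2 $ 3, T $ 3 $ 1, T $ 1 $ 2])"

definition P_t :: "real \<Rightarrow> real^4 \<Rightarrow> real^4 \<Rightarrow> real^4^4 \<Rightarrow> real" where
  "P_t \<mu> y p S = lower (schwarzschild \<mu>) y p $ 0 + \<mu> / (y $ 1)\<^sup>2 * M_vec \<mu> y S $ 1"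

definition P_r :: "real \<Rightarrow> real^4 \<Rightarrow> real^4 \<Rightarrow> real" where
  "P_r \<mu> y p = lower (schwarzschild \<mu>) y p $ 1"

definition P_theta :: "real \<Rightarrow> real^4 \<Rightarrow> real^4 \<Rightarrow> real^4^4 \<Rightarrow> real" where
  "P_theta \<mu> y p S =
     lower (schwarzschild \<mu>) y p $ 2 + sqrt (schw_a \<mu> (y $ 1)) * L_vec \<mu> y S $ 3"

definition P_phi :: "real \<Rightarrow> real^4 \<Rightarrow> real^4 \<Rightarrow> real^4^4 \<Rightarrow> real" where
  "P_phi \<mu> y p S =
     lower (schwarzschild \<mu>) y p $ 3
     - sqrt (schw_a \<mu> (y $ 1)) * sin (y $ 2) * L_vec \<mu> y S $ 2 + cos (y $ 2) * L_vec \<mu> y S $ 1"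

definition total_angular_momentum :: "real \<Rightarrow> real^4 \<Rightarrow> real^4 \<Rightarrow> real^4^4 \<Rightarrow> real^3" where
  "total_angular_momentum \<mu> y p S =
     (let \<theta> = y $ 2; \<phi> = y $ 3; L1 = L_vec \<mu> y S $ 1;
          P\<theta> = P_theta \<mu> y p S; P\<phi> = P_phi \<mu> y p S
      in vector [cos \<phi> / sin \<theta> * (L1 - P\<phi> * cos \<theta>) - P\<theta> * sin \<phi>,
                 sin \<phi> / sin \<theta> * (L1 - P\<phi> * cos \<theta>) + P\<theta> * cos \<phi>,
                 P\<phi>])"

lemma invertible_tetrad:
  assumes "\<mu> > 0" "y $ 1 > 2 * \<mu>" "sin (y $ 2) \<noteq> 0"
  shows "invertible (tetrad \<mu> y)"
proof -
  have "schw_a \<mu> (y $ 1) > 0" "y $ 1 > 0"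
    using assms by (auto simp: schw_a_def field_simps)
  then have "tetrad \<mu> y $ i $ i \<noteq> 0" for i
    using assms(3) by (auto simp: tetrad_def)
  moreover have "det (tetrad \<mu> y) = (\<Prod>i\<in>UNIV. tetrad \<mu> y $ i $ i)"
    by (rule det_diagonal) (simp add: tetrad_def)
  ultimately show ?thesis
    by (simp add: invertible_det_nz)
qed

lemma tetrad_spin_expansion:
  assumes "\<mu> > 0" "y $ 1 > 2 * \<mu>" "sin (y $ 2) \<noteq> 0"
  shows "S $ \<alpha> $ \<beta> =
    (\<Sum>A\<in>UNIV. \<Sum>B\<in>UNIV. tetrad_spin \<mu> y S $ A $ B * tetrad \<mu> y $ A $ \<alpha> * tetrad \<mu> y $ B $ \<beta>)"
proof -
  let ?E = "tetrad \<mu> y" and ?T = "tetrad_spin \<mu> y S"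
  have inv_left: "matrix_inv ?E ** ?E = mat 1"
    using invertible_tetrad[OF assms] unfolding invertible_def matrix_inv_def
    by (rule someI_ex[THEN conjunct2])
  have "transpose ?E ** ?T ** ?E
      = transpose (matrix_inv ?E ** ?E) ** S ** (matrix_inv ?E ** ?E)"
    by (simp add: tetrad_spin_def matrix_transpose_mul matrix_mul_assoc)
  then have "S = transpose ?E ** ?T ** ?E"
    using inv_left by (simp add: transpose_mat)
  then have "S $ \<alpha> $ \<beta> = (transpose ?E ** ?T ** ?E) $ \<alpha> $ \<beta>"
    by simp
  also have "\<dots> = (\<Sum>B\<in>UNIV. \<Sum>A\<in>UNIV. ?T $ A $ B * ?E $ A $ \<alpha> * ?E $ B $ \<beta>)"
    by (simp add: matrix_matrix_mult_def transpose_def sum_distrib_left sum_distrib_right mult_ac)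
  also have "\<dots> = (\<Sum>A\<in>UNIV. \<Sum>B\<in>UNIV. ?T $ A $ B * ?E $ A $ \<alpha> * ?E $ B $ \<beta>)"
    by (rule sum.swap)
  finally show ?thesis .
qed

definition N_fun :: "real \<Rightarrow> real \<Rightarrow> real \<Rightarrow> real \<Rightarrow> real \<Rightarrow> real" where
  "N_fun \<mu> m c \<E> r =
     r^4 * (m\<^sup>2 * r\<^sup>2 - c\<^sup>2 * schw_a \<mu> r) * \<E>\<^sup>2 - schw_a \<mu> r * (m\<^sup>2 * r^3 - \<mu> * c\<^sup>2)\<^sup>2"

definition eta_fun :: "real \<Rightarrow> real \<Rightarrow> real \<Rightarrow> real \<Rightarrow> real \<Rightarrow> real" where
  "eta_fun \<mu> m c \<E> r =
     m\<^sup>2 * r^3 - \<mu> * c\<^sup>2 - 3 * \<mu> * c^4 * r^4 * \<E>\<^sup>2 / (m\<^sup>2 * r^3 - \<mu> * c\<^sup>2)\<^sup>2"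

definition Phi_fun :: "real \<Rightarrow> real \<Rightarrow> real \<Rightarrow> real \<Rightarrow> real \<Rightarrow> real" where
  "Phi_fun \<mu> m c \<E> r =
     - c * \<E> * r * (m\<^sup>2 * r^3 + 2 * \<mu> * c\<^sup>2) / (m\<^sup>2 * r^3 - \<mu> * c\<^sup>2)"

definition K_fun :: "real \<Rightarrow> real^4 \<Rightarrow> real^4^4 \<Rightarrow> real" where
  "K_fun \<mu> y S =
     L_vec \<mu> y S $ 2 * sin (y $ 2) / sqrt ((L_vec \<mu> y S $ 2)\<^sup>2 + (L_vec \<mu> y S $ 3)\<^sup>2)"

end

theory Submission
  imports Defs
begin

text \<open>
  Since \<open>Q = 0\<close> forces \<open>P\<^sub>\<theta> = P\<^sub>\<phi> = L\<^sub>1 = 0\<close>, the angular momenta \<open>p\<^sub>\<theta>, p\<^sub>\<phi>\<close> are multiples of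
  \<open>L\<^sub>3, L\<^sub>2\<close>, and the Tulczyjew, mass and spin conditions express all components of \<open>S\<close> and
  \<open>p\<close> through \<open>r\<close>, the energy and the direction of \<open>L\<close>. The velocity is then found by
  differentiating these algebraic relations along the motion, with the derivatives of \<open>S\<close> taken
  from the spin equation: the transverse part of the velocity vanishes because
  \<open>S\<^sup>0\<^sup>2 S\<^sup>1\<^sup>3 = S\<^sup>0\<^sup>3 S\<^sup>1\<^sup>2\<close>, the radial component of the Tulczyjew condition together with
  conservation of energy gives \<open>dr/d\<tau>\<close>, and its time component gives \<open>dt/d\<tau>\<close>. Apart from
  conservation of energy, only the radial component of the equation for \<open>p\<close> is used, so \<open>R\<^sup>1\<^sub>\<nu>\<^sub>\<alpha>\<^sub>\<beta>\<close> is the only part of the curvature that is needed.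
\<close>

section \<open>Schwarzschild geometry\<close>

lemma UNIV_4_from_0: "(UNIV :: 4 set) = {0, 1, 2, 3}"
  unfolding UNIV_4 by auto

text \<open>The standard expansion runs over 1, 2, 3, 4. In this type the numeral 4 is 0, so the
  time index comes last there and is moved to the front.\<close>

lemma sum_4_from_0: "sum f (UNIV :: 4 set) = f 0 + f 1 + f 2 + f 3"
proof -
  have "(4::4) = 0" by simp
  then have "sum f UNIV = f 1 + f 2 + f 3 + f 0"
    unfolding sum_4 by (simp only:)
  then show ?thesis by (simp add: ac_simps)
qed

lemma exhaust_4_from_0: "(x::4) = 0 \<or> x = 1 \<or> x = 2 \<or> x = 3"
  using UNIV_4_from_0 by blast

lemma forall_4_from_0: "(\<forall>i::4. P i) \<longleftrightarrow> P 0 \<and> P 1 \<and> P 2 \<and> P 3"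
proof -
  have "(\<forall>i::4. P i) \<longleftrightarrow> (\<forall>i\<in>{0, 1, 2, 3}. P i)"
    by (simp only: UNIV_4_from_0[symmetric] ball_UNIV)
  then show ?thesis by simp
qed

lemma partial_eqI:
  "((\<lambda>s. f (y + s *\<^sub>R axis \<alpha> 1)) has_real_derivative D) (at 0) \<Longrightarrow> partial \<alpha> f y = D"
  unfolding partial_def by (rule DERIV_imp_deriv)

text \<open>A closed form valid only outside the horizon and off the axis may still be
  differentiated there, because that region is open.\<close>

lemma partial_cong_open:
  assumes "open U" "y \<in> U" "\<And>z. z \<in> U \<Longrightarrow> f z = g z"
  shows "partial \<alpha> f y = partial \<alpha> g y"
proof -
  have "open ((\<lambda>s::real. y + s *\<^sub>R axis \<alpha> 1) -` U)"
    using assms(1) by (intro open_vimage continuous_intros)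
  from eventually_nhds_in_open[OF this, of 0]
  have "\<forall>\<^sub>F s in nhds (0::real). y + s *\<^sub>R axis \<alpha> 1 \<in> U"
    using assms(2) by simp
  then show ?thesis
    unfolding partial_def by (intro deriv_cong_ev refl) (auto elim!: eventually_mono simp: assms(3))
qed

definition schw_exterior :: "real \<Rightarrow> (real^4) set" where
  "schw_exterior \<mu> = {y. y $ 1 > 2 * \<mu> \<and> sin (y $ 2) \<noteq> 0}"

lemma open_schw_exterior: "open (schw_exterior \<mu>)"
proof -
  have "open {y::real^4. y $ 1 > 2 * \<mu>}" "open {y::real^4. sin (y $ 2) \<noteq> 0}"
    by (auto intro!: open_Collect_less open_Collect_neq continuous_intros)
  then show ?thesis
    unfolding schw_exterior_def Collect_conj_eq by (rule open_Int)
qed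

section \<open>Christoffel symbols outside the horizon\<close>

definition schw_gamma :: "real \<Rightarrow> real^4 \<Rightarrow> 4 \<Rightarrow> 4 \<Rightarrow> 4 \<Rightarrow> real" where
  "schw_gamma \<mu> y \<alpha> \<beta> \<gamma> = (let r = y $ 1; a = schw_a \<mu> r; s = sin (y $ 2) in
     if \<alpha> = 0 \<and> (\<beta> = 0 \<and> \<gamma> = 1 \<or> \<beta> = 1 \<and> \<gamma> = 0) then \<mu> / (r\<^sup>2 * a)
     else if \<alpha> = 1 \<and> \<beta> = 0 \<and> \<gamma> = 0 then a * \<mu> / r\<^sup>2
     else if \<alpha> = 1 \<and> \<beta> = 1 \<and> \<gamma> = 1 then - (\<mu> / (r\<^sup>2 * a))
     else if \<alpha> = 1 \<and> \<beta> = 2 \<and> \<gamma> = 2 then - (r * a)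
     else if \<alpha> = 1 \<and> \<beta> = 3 \<and> \<gamma> = 3 then - (r * a * s\<^sup>2)
     else if \<alpha> = 2 \<and> (\<beta> = 1 \<and> \<gamma> = 2 \<or> \<beta> = 2 \<and> \<gamma> = 1) then 1 / r
     else if \<alpha> = 2 \<and> \<beta> = 3 \<and> \<gamma> = 3 then - (s * cos (y $ 2))
     else if \<alpha> = 3 \<and> (\<beta> = 1 \<and> \<gamma> = 3 \<or> \<beta> = 3 \<and> \<gamma> = 1) then 1 / r
     else if \<alpha> = 3 \<and> (\<beta> = 2 \<and> \<gamma> = 3 \<or> \<beta> = 3 \<and> \<gamma> = 2) then cos (y $ 2) / s
     else 0)"

lemma schw_a_pos: "\<mu> > 0 \<Longrightarrow> r > 2 * \<mu> \<Longrightarrow> schw_a \<mu> r > 0"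
  by (simp add: schw_a_def field_simps)

text \<open>\<open>matrix_inv\<close> is a Hilbert choice, so the exhibited inverse is needed first
  to know that the chosen matrix is an inverse at all; associativity then identifies the
  two.\<close>

lemma matrix_inv_unique:
  fixes A B :: "real^'n^'n"
  assumes "A ** B = mat 1" "B ** A = mat 1"
  shows "matrix_inv A = B"
proof -
  have "A ** matrix_inv A = mat 1 \<and> matrix_inv A ** A = mat 1"
    unfolding matrix_inv_def by (rule someI[of _ B]) (use assms in blast)
  then have "matrix_inv A = (B ** A) ** matrix_inv A"
    by (simp add: assms(2))
  also have "\<dots> = B"
    unfolding matrix_mul_assoc[symmetric] using \<open>A ** matrix_inv A = mat 1 \<and> _\<close> by simp
  finally show ?thesis .
qed

lemma schwarzschild_inverse:
  assumes "\<mu> > 0" "y \<in> schw_exterior \<mu>"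
  shows "matrix_inv (schwarzschild \<mu> y) =
    (\<chi> \<alpha> \<beta>. if \<alpha> = \<beta> then 1 / schwarzschild \<mu> y $ \<alpha> $ \<alpha> else 0)"
proof (rule matrix_inv_unique)
  have pos: "schw_a \<mu> (y $ 1) > 0" "y $ 1 > 0" "sin (y $ 2) \<noteq> 0"
    using assms by (auto simp: schw_exterior_def schw_a_pos)
  let ?D = "\<chi> \<alpha> \<beta>. if \<alpha> = \<beta> then 1 / schwarzschild \<mu> y $ \<alpha> $ \<alpha> else 0"
  show "schwarzschild \<mu> y ** ?D = mat 1" "?D ** schwarzschild \<mu> y = mat 1"
    using pos unfolding vec_eq_iff forall_4_from_0
    by (simp_all add: schwarzschild_def matrix_matrix_mult_def mat_def sum_4_from_0)
qed

text \<open>The first index \<open>\<beta>\<close> is the direction of differentiation; the other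
  two select the component of the metric.\<close>

definition schw_dg :: "real \<Rightarrow> real^4 \<Rightarrow> 4 \<Rightarrow> 4 \<Rightarrow> 4 \<Rightarrow> real" where
  "schw_dg \<mu> y \<beta> \<sigma> \<gamma> =
    (if \<sigma> \<noteq> \<gamma> then 0
     else if \<beta> = 1 \<and> \<sigma> = 0 then - (2 * \<mu> / (y $ 1)\<^sup>2)
     else if \<beta> = 1 \<and> \<sigma> = 1 then - (2 * \<mu> / (y $ 1)\<^sup>2) / (schw_a \<mu> (y $ 1))\<^sup>2
     else if \<beta> = 1 \<and> \<sigma> = 2 then 2 * y $ 1
     else if \<beta> = 1 \<and> \<sigma> = 3 then 2 * y $ 1 * (sin (y $ 2))\<^sup>2
     else if \<beta> = 2 \<and> \<sigma> = 3 then 2 * (y $ 1)\<^sup>2 * sin (y $ 2) * cos (y $ 2)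
     else 0)"

lemma partial_schwarzschild:
  assumes "\<mu> > 0" "y \<in> schw_exterior \<mu>"
  shows "partial \<beta> (\<lambda>z. schwarzschild \<mu> z $ \<sigma> $ \<gamma>) y = schw_dg \<mu> y \<beta> \<sigma> \<gamma>"
proof (rule partial_eqI)
  have pos: "schw_a \<mu> (y $ 1) \<noteq> 0" "y $ 1 > 0" "sin (y $ 2) \<noteq> 0"
    using assms schw_a_pos[of \<mu> "y $ 1"] by (auto simp: schw_exterior_def)
  \<comment> \<open>The metric depends on r and \<theta> only. Keeping the rates \<open>b1\<close>
    and \<open>b2\<close> of these two coordinates symbolic lets one set of derivatives serve all
    four directions.\<close>
  define b1 b2 where b: "b1 = (axis \<beta> 1 :: real^4) $ 1" "b2 = (axis \<beta> 1 :: real^4) $ 2"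
  have da: "((\<lambda>s. schw_a \<mu> (y $ 1 + s * b1)) has_real_derivative 2 * \<mu> / (y $ 1)\<^sup>2 * b1) (at 0)"
    unfolding schw_a_def using pos by (auto intro!: derivative_eq_intros simp: power2_eq_square)
  have "((\<lambda>s. 1 / schw_a \<mu> (y $ 1 + s * b1)) has_real_derivative
      - (2 * \<mu> / (y $ 1)\<^sup>2 * b1) / (schw_a \<mu> (y $ 1))\<^sup>2) (at 0)"
    using pos by (auto intro!: derivative_eq_intros da simp: power2_eq_square)
  moreover have "((\<lambda>s. - schw_a \<mu> (y $ 1 + s * b1)) has_real_derivative
      - (2 * \<mu> / (y $ 1)\<^sup>2 * b1)) (at 0)"
    by (auto intro!: derivative_eq_intros da)
  moreover have "((\<lambda>s. (y $ 1 + s * b1)\<^sup>2) has_real_derivative 2 * y $ 1 * b1) (at 0)"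
    by (auto intro!: derivative_eq_intros)
  moreover have "((\<lambda>s. (y $ 1 + s * b1)\<^sup>2 * (sin (y $ 2 + s * b2))\<^sup>2) has_real_derivative
      2 * y $ 1 * b1 * (sin (y $ 2))\<^sup>2 + 2 * (y $ 1)\<^sup>2 * sin (y $ 2) * cos (y $ 2) * b2) (at 0)"
    by (auto intro!: derivative_eq_intros)
  moreover have entries: "axis \<beta> (1::real) $ 1 = b1" "axis \<beta> (1::real) $ 2 = b2"
    by (simp_all add: b)
  moreover have "b1 = (if \<beta> = 1 then 1 else 0)" "b2 = (if \<beta> = 2 then 1 else 0)"
    by (simp_all add: b axis_def)
  moreover have "\<sigma> \<noteq> \<gamma> \<or> \<sigma> = 0 \<and> \<gamma> = 0 \<or> \<sigma> = 1 \<and> \<gamma> = 1 \<or> \<sigma> = 2 \<and> \<gamma> = 2 \<or> \<sigma> = 3 \<and> \<gamma> = 3"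
    using exhaust_4_from_0[of \<sigma>] by blast
  ultimately show "((\<lambda>s. schwarzschild \<mu> (y + s *\<^sub>R axis \<beta> 1) $ \<sigma> $ \<gamma>)
    has_real_derivative schw_dg \<mu> y \<beta> \<sigma> \<gamma>) (at 0)"
    by (cases "\<beta> = 1"; cases "\<beta> = 2"; elim disjE) (simp_all add: schwarzschild_def schw_dg_def)
qed

lemma christoffel_schwarzschild:
  assumes "\<mu> > 0" "y \<in> schw_exterior \<mu>"
  shows "christoffel (schwarzschild \<mu>) y \<alpha> \<beta> \<gamma> = schw_gamma \<mu> y \<alpha> \<beta> \<gamma>"
proof -
  have pos: "schw_a \<mu> (y $ 1) > 0" "y $ 1 > 0" "sin (y $ 2) \<noteq> 0"
    using assms by (auto simp: schw_exterior_def schw_a_pos)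
  \<comment> \<open>The inverse metric is diagonal, so only the term with \<sigma> = \<alpha>
    survives in the contraction.\<close>
  have *: "christoffel (schwarzschild \<mu>) y \<alpha> \<beta> \<gamma> = 1/2 * (1 / schwarzschild \<mu> y $ \<alpha> $ \<alpha>) *
      (schw_dg \<mu> y \<beta> \<alpha> \<gamma> + schw_dg \<mu> y \<gamma> \<alpha> \<beta> - schw_dg \<mu> y \<alpha> \<beta> \<gamma>)" for \<alpha> \<beta> \<gamma>
    using exhaust_4_from_0[of \<alpha>]
    by (elim disjE) (simp_all add: christoffel_def schwarzschild_inverse[OF assms]
        partial_schwarzschild[OF assms] sum_4_from_0)
  have "\<forall>\<alpha> \<beta> \<gamma>. christoffel (schwarzschild \<mu>) y \<alpha> \<beta> \<gamma> = schw_gamma \<mu> y \<alpha> \<beta> \<gamma>"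
    using pos unfolding forall_4_from_0 *
    by (simp add: schw_dg_def schw_gamma_def Let_def schwarzschild_def power2_eq_square)
  then show ?thesis by blast
qed

section \<open>Curvature components with upper index r\<close>

definition schw_dgamma1 :: "real \<Rightarrow> real^4 \<Rightarrow> 4 \<Rightarrow> 4 \<Rightarrow> 4 \<Rightarrow> real" where
  "schw_dgamma1 \<mu> y \<alpha> \<beta> \<gamma> = (let r = y $ 1; a = schw_a \<mu> r; s = sin (y $ 2) in
     if \<beta> \<noteq> \<gamma> then 0
     else if \<alpha> = 1 \<and> \<beta> = 0 then 2 * \<mu>\<^sup>2 / r^4 - 2 * a * \<mu> / r^3
     else if \<alpha> = 1 \<and> \<beta> = 1 then 2 * \<mu> / (r^3 * a) + 2 * \<mu>\<^sup>2 / (r^4 * a\<^sup>2)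
     else if \<alpha> = 1 \<and> \<beta> = 2 then - (a + 2 * \<mu> / r)
     else if \<alpha> = 1 \<and> \<beta> = 3 then - ((a + 2 * \<mu> / r) * s\<^sup>2)
     else if \<alpha> = 2 \<and> \<beta> = 3 then - (2 * r * a * s * cos (y $ 2))
     else 0)"

text \<open>The expression \<open>a + 2 * \<mu> / r\<close> is the derivative of r a. It equals 1,
  but in this form the curvature follows below with \<open>schw_a\<close> left folded.\<close>

lemma partial_schw_gamma_1:
  assumes "\<mu> > 0" "y \<in> schw_exterior \<mu>"
  shows "partial \<alpha> (\<lambda>z. schw_gamma \<mu> z 1 \<beta> \<gamma>) y = schw_dgamma1 \<mu> y \<alpha> \<beta> \<gamma>"
proof (rule partial_eqI)
  have pos: "schw_a \<mu> (y $ 1) \<noteq> 0" "y $ 1 > 0" "sin (y $ 2) \<noteq> 0"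
    using assms schw_a_pos[of \<mu> "y $ 1"] by (auto simp: schw_exterior_def)
  define b1 b2 where b: "b1 = (axis \<alpha> 1 :: real^4) $ 1" "b2 = (axis \<alpha> 1 :: real^4) $ 2"
  have da: "((\<lambda>s. schw_a \<mu> (y $ 1 + s * b1)) has_real_derivative 2 * \<mu> / (y $ 1)\<^sup>2 * b1) (at 0)"
    unfolding schw_a_def using pos by (auto intro!: derivative_eq_intros simp: power2_eq_square)
  have b_if: "b1 = (if \<alpha> = 1 then 1 else 0)" "b2 = (if \<alpha> = 2 then 1 else 0)"
    by (simp_all add: b axis_def)
  have d0: "((\<lambda>s. schw_a \<mu> (y $ 1 + s * b1) * \<mu> / (y $ 1 + s * b1)\<^sup>2) has_real_derivative
      (2 * \<mu>\<^sup>2 / (y $ 1)^4 - 2 * schw_a \<mu> (y $ 1) * \<mu> / (y $ 1)^3) * b1) (at 0)"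
    using pos by (auto intro!: derivative_eq_intros da simp: field_simps eval_nat_numeral)
  have d1: "((\<lambda>s. - (\<mu> / ((y $ 1 + s * b1)\<^sup>2 * schw_a \<mu> (y $ 1 + s * b1)))) has_real_derivative
      (2 * \<mu> / ((y $ 1)^3 * schw_a \<mu> (y $ 1)) + 2 * \<mu>\<^sup>2 / ((y $ 1)^4 * (schw_a \<mu> (y $ 1))\<^sup>2)) * b1) (at 0)"
    using pos by (auto intro!: derivative_eq_intros da simp: field_simps eval_nat_numeral)
  have d2: "((\<lambda>s. - ((y $ 1 + s * b1) * schw_a \<mu> (y $ 1 + s * b1))) has_real_derivative
      - (schw_a \<mu> (y $ 1) + 2 * \<mu> / y $ 1) * b1) (at 0)"
    using pos by (auto intro!: derivative_eq_intros da simp: field_simps eval_nat_numeral)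
  have d3: "((\<lambda>s. - ((y $ 1 + s * b1) * schw_a \<mu> (y $ 1 + s * b1) * (sin (y $ 2 + s * b2))\<^sup>2))
     has_real_derivative - ((schw_a \<mu> (y $ 1) + 2 * \<mu> / y $ 1) * (sin (y $ 2))\<^sup>2) * b1
      - (2 * y $ 1 * schw_a \<mu> (y $ 1) * sin (y $ 2) * cos (y $ 2)) * b2) (at 0)"
    using pos by (auto intro!: derivative_eq_intros da simp: field_simps eval_nat_numeral)
  have gamma: "schw_gamma \<mu> (y + s *\<^sub>R axis \<alpha> 1) 1 \<beta> \<gamma> = (if \<beta> \<noteq> \<gamma> then 0
      else if \<beta> = 0 then schw_a \<mu> (y $ 1 + s * b1) * \<mu> / (y $ 1 + s * b1)\<^sup>2
      else if \<beta> = 1 then - (\<mu> / ((y $ 1 + s * b1)\<^sup>2 * schw_a \<mu> (y $ 1 + s * b1)))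
      else if \<beta> = 2 then - ((y $ 1 + s * b1) * schw_a \<mu> (y $ 1 + s * b1))
      else - ((y $ 1 + s * b1) * schw_a \<mu> (y $ 1 + s * b1) * (sin (y $ 2 + s * b2))\<^sup>2))" for s
    using exhaust_4_from_0[of \<beta>] by (elim disjE) (auto simp: schw_gamma_def Let_def b)
  have dgamma: "schw_dgamma1 \<mu> y \<alpha> \<beta> \<gamma> = (if \<beta> \<noteq> \<gamma> then 0
      else if \<beta> = 0 then (2 * \<mu>\<^sup>2 / (y $ 1)^4 - 2 * schw_a \<mu> (y $ 1) * \<mu> / (y $ 1)^3) * b1
      else if \<beta> = 1 then (2 * \<mu> / ((y $ 1)^3 * schw_a \<mu> (y $ 1)) + 2 * \<mu>\<^sup>2 / ((y $ 1)^4 * (schw_a \<mu> (y $ 1))\<^sup>2)) * b1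
      else if \<beta> = 2 then - (schw_a \<mu> (y $ 1) + 2 * \<mu> / y $ 1) * b1
      else - ((schw_a \<mu> (y $ 1) + 2 * \<mu> / y $ 1) * (sin (y $ 2))\<^sup>2) * b1
      - (2 * y $ 1 * schw_a \<mu> (y $ 1) * sin (y $ 2) * cos (y $ 2)) * b2)"
    using exhaust_4_from_0[of \<beta>] by (elim disjE) (auto simp: schw_dgamma1_def Let_def b_if)
  show "((\<lambda>s. schw_gamma \<mu> (y + s *\<^sub>R axis \<alpha> 1) 1 \<beta> \<gamma>)
    has_real_derivative schw_dgamma1 \<mu> y \<alpha> \<beta> \<gamma>) (at 0)"
    unfolding gamma dgamma using exhaust_4_from_0[of \<beta>] d0 d1 d2 d3
    by (cases "\<beta> = \<gamma>"; elim disjE) simp_all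
qed

text \<open>This is what the radial momentum equation takes from the curvature. The derivatives come
  from the closed form of the symbols, and the identity is then checked for every choice of the
  three lower indices.\<close>

lemma riemann_schwarzschild_1:
  assumes "\<mu> > 0" "y \<in> schw_exterior \<mu>"
  shows "riemann (schwarzschild \<mu>) y 1 \<nu> \<alpha> \<beta> =
    (let r = y $ 1; s = sin (y $ 2)
     in if \<nu> = 0 \<and> \<alpha> = 0 \<and> \<beta> = 1 then 2 * schw_a \<mu> r * \<mu> / r^3
     else if \<nu> = 0 \<and> \<alpha> = 1 \<and> \<beta> = 0 then - (2 * schw_a \<mu> r * \<mu> / r^3)
     else if \<nu> = 2 \<and> \<alpha> = 1 \<and> \<beta> = 2 then - (\<mu> / r)
     else if \<nu> = 2 \<and> \<alpha> = 2 \<and> \<beta> = 1 then \<mu> / r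
     else if \<nu> = 3 \<and> \<alpha> = 1 \<and> \<beta> = 3 then - (\<mu> / r * s\<^sup>2)
     else if \<nu> = 3 \<and> \<alpha> = 3 \<and> \<beta> = 1 then \<mu> / r * s\<^sup>2
     else 0)" (is "?L \<nu> \<alpha> \<beta> = ?R \<nu> \<alpha> \<beta>")
proof -
  have pos: "schw_a \<mu> (y $ 1) > 0" "y $ 1 > 0" "sin (y $ 2) \<noteq> 0"
    using assms by (auto simp: schw_exterior_def schw_a_pos)
  have part: "partial \<alpha> (\<lambda>z. christoffel (schwarzschild \<mu>) z 1 \<beta> \<nu>) y = schw_dgamma1 \<mu> y \<alpha> \<beta> \<nu>" for \<alpha> \<beta> \<nu>
    using partial_cong_open[OF open_schw_exterior assms(2), of "\<lambda>z. christoffel (schwarzschild \<mu>) z 1 \<beta> \<nu>"]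
      christoffel_schwarzschild[OF assms(1)] partial_schw_gamma_1[OF assms] by simp
  have *: "?L \<nu> \<alpha> \<beta> = schw_dgamma1 \<mu> y \<alpha> \<beta> \<nu> - schw_dgamma1 \<mu> y \<beta> \<alpha> \<nu>
     + (schw_gamma \<mu> y 1 \<alpha> \<alpha> * schw_gamma \<mu> y \<alpha> \<beta> \<nu> - schw_gamma \<mu> y 1 \<beta> \<beta> * schw_gamma \<mu> y \<beta> \<alpha> \<nu>)" for \<nu> \<alpha> \<beta>
  proof -
    \<comment> \<open>With upper index 1 the symbols are diagonal in the lower pair, so each
      quadratic sum in the curvature has a single term.\<close>
    have diag: "schw_gamma \<mu> y 1 \<alpha> \<rho> = 0" if "\<alpha> \<noteq> \<rho>" for \<alpha> \<rho>
      using that by (auto simp: schw_gamma_def Let_def)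
    have "(\<Sum>\<rho>\<in>UNIV. schw_gamma \<mu> y 1 \<alpha> \<rho> * schw_gamma \<mu> y \<rho> \<beta> \<nu>) =
        schw_gamma \<mu> y 1 \<alpha> \<alpha> * schw_gamma \<mu> y \<alpha> \<beta> \<nu>" for \<alpha> \<beta>
      by (rule trans[OF sum.mono_neutral_right[of _ "{\<alpha>}"]]) (auto simp: diag)
    then show ?thesis
      by (simp add: riemann_def part christoffel_schwarzschild[OF assms] sum_subtractf)
  qed
  have "\<forall>\<nu> \<alpha> \<beta>. ?L \<nu> \<alpha> \<beta> = ?R \<nu> \<alpha> \<beta>"
    using pos unfolding forall_4_from_0 *
    by (simp add: schw_gamma_def schw_dgamma1_def Let_def field_simps eval_nat_numeral)
  then show ?thesis by blast
qed

section \<open>The equations of motion in coordinate components\<close>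

lemma has_real_derivative_vec_nth:
  assumes "f differentiable (at \<tau>)"
  shows "((\<lambda>\<sigma>. f \<sigma> $ i) has_real_derivative vector_derivative f (at \<tau>) $ i) (at \<tau>)"
  using bounded_linear.has_vector_derivative[OF bounded_linear_vec_nth
      assms[unfolded vector_derivative_works]]
  by (simp add: has_real_derivative_iff_has_vector_derivative)

lemma has_real_derivative_vec_nth2:
  fixes f :: "real \<Rightarrow> real^'n^'m"
  assumes "f differentiable (at \<tau>)"
  shows "((\<lambda>\<sigma>. f \<sigma> $ i $ j) has_real_derivative vector_derivative f (at \<tau>) $ i $ j) (at \<tau>)"
  using bounded_linear.has_vector_derivative[OF bounded_linear_vec_nth
      bounded_linear.has_vector_derivative[OF bounded_linear_vec_nth
      assms[unfolded vector_derivative_works]]]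
  by (simp add: has_real_derivative_iff_has_vector_derivative)

text \<open>The equations of motion solved for ordinary derivatives. The sixth spin component will
  vanish by \<open>Q = 0\<close>, the tangential momenta will be spin components, and the energy
  will supply \<open>p\<^sup>0\<close>; hence this selection of components.\<close>

lemma mpd_schwarzschild_components:
  fixes u :: "real^4"
  assumes "\<mu> > 0" "y \<tau> \<in> schw_exterior \<mu>" "mpd_motion (schwarzschild \<mu>) I y p S" "\<tau> \<in> I"
  defines "r \<equiv> y \<tau> $ 1" and "s \<equiv> sin (y \<tau> $ 2)" and "co \<equiv> cos (y \<tau> $ 2)"
    and "a \<equiv> schw_a \<mu> (y \<tau> $ 1)" and "u \<equiv> velocity y \<tau>" and "P \<equiv> p \<tau>" and "W \<equiv> S \<tau>"
  shows "((\<lambda>\<sigma>. y \<sigma> $ i) has_real_derivative u $ i) (at \<tau>)"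
    and "((\<lambda>\<sigma>. p \<sigma> $ 1) has_real_derivative
      - a * \<mu> / r\<^sup>2 * u $ 0 * P $ 0 + \<mu> / (r\<^sup>2 * a) * u $ 1 * P $ 1
      + r * a * (u $ 2 * P $ 2 + s\<^sup>2 * u $ 3 * P $ 3)
      - 2 * a * \<mu> / r^3 * u $ 0 * W $ 0 $ 1
      + \<mu> / r * (u $ 2 * W $ 1 $ 2 + s\<^sup>2 * u $ 3 * W $ 1 $ 3)) (at \<tau>)"
    and "((\<lambda>\<sigma>. S \<sigma> $ 0 $ 1) has_real_derivative
      P $ 0 * u $ 1 - u $ 0 * P $ 1 + r * a * (u $ 2 * W $ 0 $ 2 + s\<^sup>2 * u $ 3 * W $ 0 $ 3)) (at \<tau>)"
    and "((\<lambda>\<sigma>. S \<sigma> $ 0 $ 2) has_real_derivative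
      P $ 0 * u $ 2 - u $ 0 * P $ 2 - \<mu> / (r\<^sup>2 * a) * (u $ 0 * W $ 1 $ 2 + u $ 1 * W $ 0 $ 2)
      - (u $ 1 * W $ 0 $ 2 + u $ 2 * W $ 0 $ 1) / r + s * co * u $ 3 * W $ 0 $ 3) (at \<tau>)"
    and "((\<lambda>\<sigma>. S \<sigma> $ 0 $ 3) has_real_derivative
      P $ 0 * u $ 3 - u $ 0 * P $ 3 - \<mu> / (r\<^sup>2 * a) * (u $ 0 * W $ 1 $ 3 + u $ 1 * W $ 0 $ 3)
      - (u $ 1 * W $ 0 $ 3 + u $ 3 * W $ 0 $ 1) / r
      - co / s * (u $ 2 * W $ 0 $ 3 + u $ 3 * W $ 0 $ 2)) (at \<tau>)"
    and "((\<lambda>\<sigma>. S \<sigma> $ 1 $ 2) has_real_derivative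
      P $ 1 * u $ 2 - u $ 1 * P $ 2 - a * \<mu> / r\<^sup>2 * u $ 0 * W $ 0 $ 2
      + (\<mu> / (r\<^sup>2 * a) - 1 / r) * u $ 1 * W $ 1 $ 2 - r * a * s\<^sup>2 * u $ 3 * W $ 2 $ 3
      + s * co * u $ 3 * W $ 1 $ 3) (at \<tau>)"
    and "((\<lambda>\<sigma>. S \<sigma> $ 1 $ 3) has_real_derivative
      P $ 1 * u $ 3 - u $ 1 * P $ 3 - a * \<mu> / r\<^sup>2 * u $ 0 * W $ 0 $ 3
      + (\<mu> / (r\<^sup>2 * a) - 1 / r) * u $ 1 * W $ 1 $ 3 + r * a * u $ 2 * W $ 2 $ 3
      - co / s * (u $ 2 * W $ 1 $ 3 + u $ 3 * W $ 1 $ 2)) (at \<tau>)"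
proof -
  have dy: "y differentiable (at \<tau>)" and dp: "p differentiable (at \<tau>)" and dS: "S differentiable (at \<tau>)"
    and anti: "\<And>\<alpha> \<beta>. W $ \<beta> $ \<alpha> = - W $ \<alpha> $ \<beta>"
    and Dp: "cov_deriv_vec (schwarzschild \<mu>) y p \<tau> 1 =
            - 1/2 * (\<Sum>\<rho>\<in>UNIV. \<Sum>\<mu>'\<in>UNIV. \<Sum>\<nu>\<in>UNIV.
                riemann (schwarzschild \<mu>) (y \<tau>) 1 \<rho> \<mu>' \<nu> * u $ \<rho> * W $ \<mu>' $ \<nu>)"
    and DS: "\<And>\<alpha> \<beta>. cov_deriv_tensor (schwarzschild \<mu>) y S \<tau> \<alpha> \<beta> = P $ \<alpha> * u $ \<beta> - u $ \<alpha> * P $ \<beta>"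
    using assms(3,4) unfolding mpd_motion_def u_def P_def W_def by blast+
  have pos: "a > 0" "r > 0" "s \<noteq> 0"
    using assms(1,2) by (auto simp: schw_exterior_def schw_a_pos a_def r_def s_def)
  have schw_a_r: "schw_a \<mu> r = a"
    by (simp add: a_def r_def)
  have skew: "W $ 1 $ 0 = - W $ 0 $ 1" "W $ 2 $ 0 = - W $ 0 $ 2" "W $ 3 $ 0 = - W $ 0 $ 3"
    "W $ 2 $ 1 = - W $ 1 $ 2" "W $ 3 $ 1 = - W $ 1 $ 3" "W $ 3 $ 2 = - W $ 2 $ 3"
    by (rule anti)+
  have diag: "W $ \<alpha> $ \<alpha> = 0" for \<alpha>
    using anti[of \<alpha> \<alpha>] by linarith
  note chr = christoffel_schwarzschild[OF assms(1,2)]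
  have expand: "vector_derivative S (at \<tau>) $ \<alpha> $ \<beta> = P $ \<alpha> * u $ \<beta> - u $ \<alpha> * P $ \<beta>
     - (\<Sum>\<gamma>\<in>UNIV. \<Sum>\<delta>\<in>UNIV.
          schw_gamma \<mu> (y \<tau>) \<alpha> \<gamma> \<delta> * u $ \<gamma> * W $ \<delta> $ \<beta>
        + schw_gamma \<mu> (y \<tau>) \<beta> \<gamma> \<delta> * u $ \<gamma> * W $ \<alpha> $ \<delta>)" for \<alpha> \<beta>
    using DS[of \<alpha> \<beta>] by (simp add: cov_deriv_tensor_def chr u_def W_def)
  \<comment> \<open>The symbols are restated in the abbreviations r, a, s, co, so that the
    expansions below match the claimed right-hand sides without unfolding them.\<close>
  have gamma: "schw_gamma \<mu> (y \<tau>) = (\<lambda>\<alpha> \<beta> \<gamma>.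
     if \<alpha> = 0 \<and> (\<beta> = 0 \<and> \<gamma> = 1 \<or> \<beta> = 1 \<and> \<gamma> = 0) then \<mu> / (r\<^sup>2 * a)
     else if \<alpha> = 1 \<and> \<beta> = 0 \<and> \<gamma> = 0 then a * \<mu> / r\<^sup>2
     else if \<alpha> = 1 \<and> \<beta> = 1 \<and> \<gamma> = 1 then - (\<mu> / (r\<^sup>2 * a))
     else if \<alpha> = 1 \<and> \<beta> = 2 \<and> \<gamma> = 2 then - (r * a)
     else if \<alpha> = 1 \<and> \<beta> = 3 \<and> \<gamma> = 3 then - (r * a * s\<^sup>2)
     else if \<alpha> = 2 \<and> (\<beta> = 1 \<and> \<gamma> = 2 \<or> \<beta> = 2 \<and> \<gamma> = 1) then 1 / r
     else if \<alpha> = 2 \<and> \<beta> = 3 \<and> \<gamma> = 3 then - (s * co)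
     else if \<alpha> = 3 \<and> (\<beta> = 1 \<and> \<gamma> = 3 \<or> \<beta> = 3 \<and> \<gamma> = 1) then 1 / r
     else if \<alpha> = 3 \<and> (\<beta> = 2 \<and> \<gamma> = 3 \<or> \<beta> = 3 \<and> \<gamma> = 2) then co / s
     else 0)"
    unfolding schw_gamma_def Let_def r_def a_def s_def co_def by (intro ext) (rule refl)
  show "((\<lambda>\<sigma>. y \<sigma> $ i) has_real_derivative u $ i) (at \<tau>)"
    using has_real_derivative_vec_nth[OF dy] by (simp add: u_def velocity_def)
  \<comment> \<open>In the curvature sum each antisymmetric pair of indices occurs twice, which
    absorbs the factor 1/2.\<close>
  have "vector_derivative p (at \<tau>) $ 1 =
      - a * \<mu> / r\<^sup>2 * u $ 0 * P $ 0 + \<mu> / (r\<^sup>2 * a) * u $ 1 * P $ 1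
      + r * a * (u $ 2 * P $ 2 + s\<^sup>2 * u $ 3 * P $ 3)
      - 2 * a * \<mu> / r^3 * u $ 0 * W $ 0 $ 1
      + \<mu> / r * (u $ 2 * W $ 1 $ 2 + s\<^sup>2 * u $ 3 * W $ 1 $ 3)"
    using Dp unfolding cov_deriv_vec_def chr gamma riemann_schwarzschild_1[OF assms(1,2)]
      u_def[symmetric] P_def[symmetric] r_def[symmetric] s_def[symmetric] a_def[symmetric] Let_def
    by (simp add: sum_4_from_0 skew diag schw_a_r algebra_simps)
  then show "((\<lambda>\<sigma>. p \<sigma> $ 1) has_real_derivative
      - a * \<mu> / r\<^sup>2 * u $ 0 * P $ 0 + \<mu> / (r\<^sup>2 * a) * u $ 1 * P $ 1
      + r * a * (u $ 2 * P $ 2 + s\<^sup>2 * u $ 3 * P $ 3)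
      - 2 * a * \<mu> / r^3 * u $ 0 * W $ 0 $ 1
      + \<mu> / r * (u $ 2 * W $ 1 $ 2 + s\<^sup>2 * u $ 3 * W $ 1 $ 3)) (at \<tau>)"
    using has_real_derivative_vec_nth[OF dp, of 1] by simp
  have S': "((\<lambda>\<sigma>. S \<sigma> $ \<alpha> $ \<beta>) has_real_derivative D) (at \<tau>)"
    if "vector_derivative S (at \<tau>) $ \<alpha> $ \<beta> = D" for \<alpha> \<beta> D
    using has_real_derivative_vec_nth2[OF dS] that by blast
  show "((\<lambda>\<sigma>. S \<sigma> $ 0 $ 1) has_real_derivative
      P $ 0 * u $ 1 - u $ 0 * P $ 1 + r * a * (u $ 2 * W $ 0 $ 2 + s\<^sup>2 * u $ 3 * W $ 0 $ 3)) (at \<tau>)"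
    by (rule S') (simp add: expand gamma sum_4_from_0 skew diag algebra_simps)
  show "((\<lambda>\<sigma>. S \<sigma> $ 0 $ 2) has_real_derivative
      P $ 0 * u $ 2 - u $ 0 * P $ 2 - \<mu> / (r\<^sup>2 * a) * (u $ 0 * W $ 1 $ 2 + u $ 1 * W $ 0 $ 2)
      - (u $ 1 * W $ 0 $ 2 + u $ 2 * W $ 0 $ 1) / r + s * co * u $ 3 * W $ 0 $ 3) (at \<tau>)"
    by (rule S') (simp add: expand gamma sum_4_from_0 skew diag algebra_simps add_divide_distrib)
  show "((\<lambda>\<sigma>. S \<sigma> $ 0 $ 3) has_real_derivative
      P $ 0 * u $ 3 - u $ 0 * P $ 3 - \<mu> / (r\<^sup>2 * a) * (u $ 0 * W $ 1 $ 3 + u $ 1 * W $ 0 $ 3)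
      - (u $ 1 * W $ 0 $ 3 + u $ 3 * W $ 0 $ 1) / r
      - co / s * (u $ 2 * W $ 0 $ 3 + u $ 3 * W $ 0 $ 2)) (at \<tau>)"
    by (rule S') (simp add: expand gamma sum_4_from_0 skew diag algebra_simps add_divide_distrib)
  show "((\<lambda>\<sigma>. S \<sigma> $ 1 $ 2) has_real_derivative
      P $ 1 * u $ 2 - u $ 1 * P $ 2 - a * \<mu> / r\<^sup>2 * u $ 0 * W $ 0 $ 2
      + (\<mu> / (r\<^sup>2 * a) - 1 / r) * u $ 1 * W $ 1 $ 2 - r * a * s\<^sup>2 * u $ 3 * W $ 2 $ 3
      + s * co * u $ 3 * W $ 1 $ 3) (at \<tau>)"
    by (rule S') (simp add: expand gamma sum_4_from_0 skew diag algebra_simps add_divide_distrib)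
  show "((\<lambda>\<sigma>. S \<sigma> $ 1 $ 3) has_real_derivative
      P $ 1 * u $ 3 - u $ 1 * P $ 3 - a * \<mu> / r\<^sup>2 * u $ 0 * W $ 0 $ 3
      + (\<mu> / (r\<^sup>2 * a) - 1 / r) * u $ 1 * W $ 1 $ 3 + r * a * u $ 2 * W $ 2 $ 3
      - co / s * (u $ 2 * W $ 1 $ 3 + u $ 3 * W $ 1 $ 2)) (at \<tau>)"
    by (rule S') (simp add: expand gamma sum_4_from_0 skew diag algebra_simps add_divide_distrib)
qed

section \<open>The algebra of states with vanishing total angular momentum\<close>

text \<open>
  Here \<open>X = S\<^sup>1\<^sup>2\<close>, \<open>Y = sin \<theta> S\<^sup>1\<^sup>3\<close>, \<open>A = S\<^sup>0\<^sup>1\<close>, \<open>B = S\<^sup>0\<^sup>2\<close>, \<open>C = sin \<theta> S\<^sup>0\<^sup>3\<close>, and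
  \<open>P0\<close>, \<open>P1\<close> are the contravariant components of \<open>p\<close>; \<open>Q = 0\<close> has been used to replace
  \<open>p\<^sup>2\<close> and \<open>sin \<theta> p\<^sup>3\<close> by \<open>- X / r\<close> and \<open>- Y / r\<close>. Coordinate components avoid the
  square roots of the tetrad, and the factors \<open>sin \<theta>\<close> make \<open>(X, Y)\<close> and \<open>(B, C)\<close>
  rotate with the same angular velocity \<open>w = cos \<theta> d\<phi>/d\<tau>\<close>.
\<close>

locale vanishing_Q_state =
  fixes \<mu> m c r a P0 P1 X Y A B C :: real
  assumes pos: "\<mu> > 0" "m > 0" "c > 0" "r > 0" "a > 0"
    and a_eq: "a = 1 - 2 * \<mu> / r"
    and tul_A: "a * P0 * A = r * (X\<^sup>2 + Y\<^sup>2)"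
    and tul_B: "a\<^sup>2 * P0 * B = P1 * X"
    and tul_C: "a\<^sup>2 * P0 * C = P1 * Y"
    and mass: "a * P0\<^sup>2 - P1\<^sup>2 / a - (X\<^sup>2 + Y\<^sup>2) = m\<^sup>2"
    and spin: "- A\<^sup>2 - a * r\<^sup>2 * (B\<^sup>2 + C\<^sup>2) + r\<^sup>2 / a * (X\<^sup>2 + Y\<^sup>2) = c\<^sup>2"
begin

text \<open>\<open>\<Sigma>\<close> is the squared tangential momentum, and \<open>b\<close> is the
  factor that carries (X, Y) to (B, C). \<open>g\<close> will be the ratio of the energy to
  \<open>a * P0\<close>, and \<open>D\<close> the common denominator of all velocity components,
  equal to \<open>eta_fun\<close> divided by \<open>r^3\<close>.\<close>

definition "\<Sigma> = X\<^sup>2 + Y\<^sup>2"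
definition "g = 1 - \<mu> * c\<^sup>2 / (r^3 * m\<^sup>2)"
definition "b = P1 / (a\<^sup>2 * P0)"
definition "G = m\<^sup>2 * r^3 - \<mu> * c\<^sup>2"
definition "D = g * m\<^sup>2 - 3 * \<mu> / r^3 * A\<^sup>2"

section \<open>Consequences of the Tulczyjew, mass and spin relations\<close>

lemma P0_nz: "P0 \<noteq> 0"
proof
  assume "P0 = 0"
  then have "- (P1\<^sup>2 / a) - (X\<^sup>2 + Y\<^sup>2) = m\<^sup>2" using mass by simp
  moreover have "P1\<^sup>2 / a \<ge> 0" "m\<^sup>2 > 0" using pos by auto
  ultimately show False by (smt (verit) sum_power2_ge_zero)
qed

lemma B_eq: "B = b * X" and C_eq: "C = b * Y"
  using tul_B tul_C P0_nz pos by (simp_all add: b_def field_simps)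

lemma A_Sigma: "A = r * \<Sigma> / (a * P0)"
  using tul_A P0_nz pos by (simp add: \<Sigma>_def field_simps)

text \<open>Once A, B, C are expressed through \<open>\<Sigma>\<close>, the spin relation contains
  the left side of the mass relation as a factor. Replacing it by \<open>m\<^sup>2\<close> makes the
  equation linear in \<open>\<Sigma>\<close>.\<close>

lemma Sigma_eq: "\<Sigma> = c\<^sup>2 * a\<^sup>2 * P0\<^sup>2 / (r\<^sup>2 * m\<^sup>2)"
proof -
  have "c\<^sup>2 = - (r * \<Sigma> / (a * P0))\<^sup>2 - a * r\<^sup>2 * (b\<^sup>2 * \<Sigma>) + r\<^sup>2 / a * \<Sigma>"
    using spin unfolding A_Sigma B_eq C_eq by (simp add: \<Sigma>_def algebra_simps)
  also have "\<dots> = r\<^sup>2 * \<Sigma> / (a\<^sup>2 * P0\<^sup>2) * (a * P0\<^sup>2 - P1\<^sup>2 / a - \<Sigma>)"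
    using P0_nz pos by (simp add: b_def field_simps eval_nat_numeral)
  also have "\<dots> = r\<^sup>2 * \<Sigma> / (a\<^sup>2 * P0\<^sup>2) * m\<^sup>2"
    using mass by (simp add: \<Sigma>_def)
  finally show ?thesis using P0_nz pos by (simp add: field_simps)
qed

lemma Sigma_pos: "\<Sigma> > 0"
  unfolding Sigma_eq using P0_nz pos by simp

lemma A_eq: "A = c\<^sup>2 * a * P0 / (r * m\<^sup>2)"
  unfolding A_Sigma Sigma_eq using P0_nz pos by (simp add: field_simps eval_nat_numeral)

lemma A_sq: "A\<^sup>2 = c\<^sup>2 * \<Sigma> / m\<^sup>2"
  unfolding A_eq Sigma_eq using P0_nz pos by (simp add: field_simps eval_nat_numeral)

lemma g_Sigma: "g * \<Sigma> = \<Sigma> - \<mu> / r^3 * A\<^sup>2"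
  unfolding A_sq g_def using pos by (simp add: field_simps)

text \<open>
  In the next three lemmas, primed variables are the \<open>\<tau>\<close>-derivatives prescribed by the equations
  of motion, and \<open>const\<close> is the \<open>\<tau>\<close>-derivative of \<open>B Y = C X\<close>, of
  \<open>(E + \<mu> A / r\<^sup>2) A = r (X\<^sup>2 + Y\<^sup>2)\<close> (where \<open>E + \<mu> A / r\<^sup>2 = a P0\<close>) and of
  \<open>A P1 = (r - 2 \<mu>) (B X + C Y)\<close>, respectively.
\<close>

lemma transverse_velocity:
  assumes X': "X' = P1 * v2 + u1 * X / r - k * u0 * B + h * u1 * X + w * Y"
    and Y': "Y' = P1 * v3 + u1 * Y / r - k * u0 * C + h * u1 * Y - w * X"
    and B': "B' = P0 * v2 + u0 * X / r - j * (u0 * X + u1 * B) - (u1 * B + v2 * A) / r + w * C"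
    and C': "C' = P0 * v3 + u0 * Y / r - j * (u0 * Y + u1 * C) - (u1 * C + v3 * A) / r - w * B"
    and const: "B' * Y + B * Y' = C' * X + C * X'"
  shows "X * v3 = Y * v2"
proof -
  have "0 = B' * Y + B * Y' - C' * X - C * X'"
    using const by simp
  \<comment> \<open>Since (B, C) is \<open>b\<close> times (X, Y), all terms along (X, Y) drop out
    of this cross product, and the two rotations by \<open>w\<close> cancel.\<close>
  also have "\<dots> = (P0 - A / r - b * P1) * (Y * v2 - X * v3)"
    unfolding X' Y' B' C' unfolding B_eq C_eq
    by (simp add: algebra_simps add_divide_distrib diff_divide_distrib)
  \<comment> \<open>The remaining factor is the mass relation divided by \<open>a * P0\<close>,
    hence nonzero.\<close>
  also have "P0 - A / r - b * P1 = m\<^sup>2 / (a * P0)"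
    unfolding mass[symmetric] A_Sigma b_def \<Sigma>_def
    using P0_nz pos by (simp add: field_simps eval_nat_numeral)
  finally show ?thesis using P0_nz pos by simp
qed

text \<open>Common last step for the time and radial velocities, with (z, Z) equal to (u0, P0) or
  (u1, P1). By \<open>g_Sigma\<close> one more \<open>\<mu> / r^3 * A\<^sup>2\<close> joins the two
  on the right, which gives the 3 in \<open>D\<close>.\<close>

lemma scaled_momentum:
  assumes "g * ((a * P0\<^sup>2 - P1\<^sup>2 / a) * z - m * Z) = z * (2 * \<mu> / r^3 * A\<^sup>2 + \<Sigma>)"
  shows "D * z = g * m * Z"
proof -
  have "a * P0\<^sup>2 - P1\<^sup>2 / a = m\<^sup>2 + \<Sigma>"
    using mass by (simp add: \<Sigma>_def)
  with assms have "g * ((m\<^sup>2 + \<Sigma>) * z - m * Z) = z * (2 * \<mu> / r^3 * A\<^sup>2 + \<Sigma>)"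
    by simp
  then show ?thesis using g_Sigma by (simp add: D_def) algebra
qed

lemma radial_velocity:
  assumes X': "X' = P1 * v2 + u1 * X / r - a * \<mu> / r\<^sup>2 * u0 * B + (\<mu> / (r\<^sup>2 * a) - 1 / r) * u1 * X + w * Y"
    and Y': "Y' = P1 * v3 + u1 * Y / r - a * \<mu> / r\<^sup>2 * u0 * C + (\<mu> / (r\<^sup>2 * a) - 1 / r) * u1 * Y - w * X"
    and A': "A' = P0 * u1 - u0 * P1 + r * a * (v2 * B + v3 * C)"
    and const: "(\<mu> / r\<^sup>2 * A' - 2 * \<mu> / r^3 * u1 * A) * A + a * P0 * A' =
       u1 * (X\<^sup>2 + Y\<^sup>2) + r * (2 * X * X' + 2 * Y * Y')"
    and norm: "a * P0 * u0 - P1 * u1 / a + r * (X * v2 + Y * v3) = m"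
  shows "D * u1 = g * m * P1"
proof (rule scaled_momentum)
  \<comment> \<open>Only the projection of (v2, v3) on (X, Y) enters, and the normalization
    expresses it through u0 and u1.\<close>
  define T where "T = X * v2 + Y * v3"
  have XX: "X * X' + Y * Y' = P1 * T - \<mu> / (r\<^sup>2 * a) * u0 * P1 * \<Sigma> / P0 + \<mu> / (r\<^sup>2 * a) * u1 * \<Sigma>"
    unfolding X' Y' unfolding B_eq C_eq b_def T_def \<Sigma>_def
    using P0_nz pos by (simp add: field_simps eval_nat_numeral)
  have A'_T: "A' = P0 * u1 - u0 * P1 + r * a * b * T"
    unfolding A' B_eq C_eq T_def by (simp add: algebra_simps)
  have "u1 * (2 * \<mu> / r^3 * A\<^sup>2 + \<Sigma>) = (\<mu> / r\<^sup>2 * A + a * P0) * A' - 2 * r * (X * X' + Y * Y')"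
    using const by (simp add: \<Sigma>_def power2_eq_square algebra_simps)
  \<comment> \<open>Here \<open>\<mu> / r\<^sup>2 * A\<close> is \<open>(1 - g) * a * P0\<close>.
    The bracket contributes 2 - g and the spin terms subtract 2 (1 - g), or 2 in the coefficient of
    T, so \<open>g\<close> factors out.\<close>
  also have "\<dots> = g * (a * P0 * (P0 * u1 - P1 * u0) - P1 * (r * T))"
    unfolding XX A'_T unfolding A_eq Sigma_eq b_def g_def
    using P0_nz pos by (simp add: field_simps eval_nat_numeral)
  also have "r * T = m - a * P0 * u0 + P1 * u1 / a"
    using norm by (simp add: T_def)
  finally show "g * ((a * P0\<^sup>2 - P1\<^sup>2 / a) * u1 - m * P1) = u1 * (2 * \<mu> / r^3 * A\<^sup>2 + \<Sigma>)"
    by (simp add: power2_eq_square algebra_simps)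
qed

lemma time_velocity:
  assumes X': "X' = P1 * v2 + u1 * X / r - a * \<mu> / r\<^sup>2 * u0 * B + (\<mu> / (r\<^sup>2 * a) - 1 / r) * u1 * X + w * Y"
    and Y': "Y' = P1 * v3 + u1 * Y / r - a * \<mu> / r\<^sup>2 * u0 * C + (\<mu> / (r\<^sup>2 * a) - 1 / r) * u1 * Y - w * X"
    and B': "B' = P0 * v2 + u0 * X / r - \<mu> / (r\<^sup>2 * a) * (u0 * X + u1 * B) - (u1 * B + v2 * A) / r + w * C"
    and C': "C' = P0 * v3 + u0 * Y / r - \<mu> / (r\<^sup>2 * a) * (u0 * Y + u1 * C) - (u1 * C + v3 * A) / r - w * B"
    and A': "A' = P0 * u1 - u0 * P1 + r * a * (v2 * B + v3 * C)"
    and P1': "P1' = - a * \<mu> / r\<^sup>2 * u0 * P0 + \<mu> / (r\<^sup>2 * a) * u1 * P1 - a * (X * v2 + Y * v3)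
        - 2 * a * \<mu> / r^3 * u0 * A + \<mu> / r * (X * v2 + Y * v3)"
    and const: "A' * P1 + A * P1' = u1 * (B * X + C * Y) + r * a * (B' * X + B * X' + C' * Y + C * Y')"
    and norm: "a * P0 * u0 - P1 * u1 / a + r * (X * v2 + Y * v3) = m"
  shows "D * u0 = g * m * P0"
proof (rule scaled_momentum)
  define T where "T = X * v2 + Y * v3"
  have BX: "B * X + C * Y = b * \<Sigma>"
    unfolding B_eq C_eq \<Sigma>_def by (simp add: power2_eq_square algebra_simps)
  have A'_T: "A' = P0 * u1 - u0 * P1 + r * a * b * T"
    unfolding A' B_eq C_eq T_def by (simp add: algebra_simps)
  have P1'_T: "P1' = - a * \<mu> / r\<^sup>2 * u0 * P0 + \<mu> / (r\<^sup>2 * a) * u1 * P1 - a * T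
        - 2 * a * \<mu> / r^3 * u0 * A + \<mu> / r * T"
    unfolding P1' T_def ..
  have BX': "B' * X + B * X' + C' * Y + C * Y' = P0 * T - T * A / r + b * P1 * T + u0 * \<Sigma> / r
      - \<mu> / (r\<^sup>2 * a) * \<Sigma> * u0 - u1 * b * \<Sigma> / r - a * \<mu> / r\<^sup>2 * b\<^sup>2 * \<Sigma> * u0"
    unfolding B' X' C' Y' unfolding B_eq C_eq T_def \<Sigma>_def
    by (simp add: power2_eq_square algebra_simps add_divide_distrib diff_divide_distrib)
  \<comment> \<open>This identity is held back from the expansion below; what it removes is
    collected there in a separate last summand.\<close>
  have a_r: "a * r = r - 2 * \<mu>"
    using a_eq pos by (simp add: field_simps)
  have "0 = A' * P1 + A * P1' - u1 * (b * \<Sigma>) - r * a * (P0 * T - T * A / r + b * P1 * T + u0 * \<Sigma> / r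
      - \<mu> / (r\<^sup>2 * a) * \<Sigma> * u0 - u1 * b * \<Sigma> / r - a * \<mu> / r\<^sup>2 * b\<^sup>2 * \<Sigma> * u0)"
    using const unfolding BX BX' by simp
  also have "\<dots> = g * (P1 * (P0 * u1 - P1 * u0) - a * P0 * (r * T)) - a * u0 * (2 * \<mu> / r^3 * A\<^sup>2 + \<Sigma>)
      + (a * r - r + 2 * \<mu>) * (u1 * b * \<Sigma> / r)"
    unfolding A'_T P1'_T A_eq Sigma_eq b_def g_def
    using P0_nz pos by (simp add: field_simps eval_nat_numeral)
  also have "r * T = m - a * P0 * u0 + P1 * u1 / a"
    using norm by (simp add: T_def)
  finally have "a * (u0 * (2 * \<mu> / r^3 * A\<^sup>2 + \<Sigma>)) = a * (g * ((a * P0\<^sup>2 - P1\<^sup>2 / a) * u0 - m * P0))"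
    using pos unfolding a_r by (simp add: power2_eq_square field_simps)
  then show "g * ((a * P0\<^sup>2 - P1\<^sup>2 / a) * u0 - m * P0) = u0 * (2 * \<mu> / r^3 * A\<^sup>2 + \<Sigma>)"
    using pos by simp
qed

text \<open>Once u0 and u1 are known, the normalization of the parameter fixes the component of (v2,
  v3) along (X, Y), and parallelism leaves no other. Cancelling \<open>\<Sigma>\<close>, the squared
  length of (X, Y), gives both entries.\<close>

lemma tangential_velocity:
  assumes u1: "D * u1 = g * m * P1" and u0: "D * u0 = g * m * P0" and v: "X * v3 = Y * v2"
    and norm: "a * P0 * u0 - P1 * u1 / a + r * (X * v2 + Y * v3) = m"
  shows "m * r * D * v2 = - (m\<^sup>2 + 2 * \<mu> * c\<^sup>2 / r^3) * X"
    and "m * r * D * v3 = - (m\<^sup>2 + 2 * \<mu> * c\<^sup>2 / r^3) * Y"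
proof -
  define T where "T = X * v2 + Y * v3"
  have "r * D * T = D * m - a * P0 * (D * u0) + P1 / a * (D * u1)"
    using norm unfolding T_def[symmetric] by (simp add: norm[unfolded T_def[symmetric], symmetric] algebra_simps)
  also have "\<dots> = D * m - g * m * (a * P0\<^sup>2 - P1\<^sup>2 / a)"
    unfolding u0 u1 by (simp add: power2_eq_square algebra_simps)
  also have "a * P0\<^sup>2 - P1\<^sup>2 / a = m\<^sup>2 + \<Sigma>"
    using mass by (simp add: \<Sigma>_def)
  also have "D * m - g * m * (m\<^sup>2 + \<Sigma>) = - (\<Sigma> / m * (m\<^sup>2 + 2 * \<mu> * c\<^sup>2 / r^3))"
    unfolding D_def A_sq g_def using pos by (simp add: field_simps eval_nat_numeral)
  finally have T: "m * r * D * T = - (m\<^sup>2 + 2 * \<mu> * c\<^sup>2 / r^3) * \<Sigma>"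
    using pos by (simp add: field_simps)
  have "\<Sigma> * v2 = X * T"
    using v by (simp add: T_def \<Sigma>_def power2_eq_square algebra_simps)
  then have "\<Sigma> * (m * r * D * v2) = X * (m * r * D * T)" by algebra
  then have "\<Sigma> * (m * r * D * v2) = \<Sigma> * (- (m\<^sup>2 + 2 * \<mu> * c\<^sup>2 / r^3) * X)"
    unfolding T by (simp add: algebra_simps)
  then show "m * r * D * v2 = - (m\<^sup>2 + 2 * \<mu> * c\<^sup>2 / r^3) * X"
    using Sigma_pos by (metis mult_cancel_left less_irrefl)
  have "\<Sigma> * v3 = Y * T"
    using v by (simp add: T_def \<Sigma>_def power2_eq_square algebra_simps)
  then have "\<Sigma> * (m * r * D * v3) = Y * (m * r * D * T)" by algebra
  then have "\<Sigma> * (m * r * D * v3) = \<Sigma> * (- (m\<^sup>2 + 2 * \<mu> * c\<^sup>2 / r^3) * Y)"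
    unfolding T by (simp add: algebra_simps)
  then show "m * r * D * v3 = - (m\<^sup>2 + 2 * \<mu> * c\<^sup>2 / r^3) * Y"
    using Sigma_pos by (metis mult_cancel_left less_irrefl)
qed

section \<open>Closed forms in the conserved energy\<close>

context
  fixes E :: real
  assumes energy: "E = a * P0 - \<mu> / r\<^sup>2 * A" and E_pos: "E * (m\<^sup>2 * r^3 - \<mu> * c\<^sup>2) > 0"
begin

lemma EG: "E * G > 0" and G_nz: "G \<noteq> 0" and E_nz: "E \<noteq> 0"
  using E_pos by (auto simp: G_def)

lemma g_G: "g = G / (m\<^sup>2 * r^3)"
  using pos by (simp add: g_def G_def field_simps)

text \<open>A is itself a multiple of \<open>a * P0\<close>, so the energy is
  \<open>g * a * P0\<close> and can be inverted as long as \<open>G\<close> is nonzero.\<close>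

lemma aP0_eq: "a * P0 = E * m\<^sup>2 * r^3 / G"
proof -
  have "E = a * P0 * g"
    unfolding energy A_eq g_def using pos by (simp add: field_simps eval_nat_numeral)
  then show ?thesis unfolding g_G using G_nz pos by (simp add: field_simps)
qed

lemma P0_eq: "P0 = E * m\<^sup>2 * r^3 / (G * a)"
proof -
  have "P0 = a * P0 / a" using pos by simp
  then show ?thesis unfolding aP0_eq by simp
qed

lemma A_E: "A = c\<^sup>2 * E * r\<^sup>2 / G"
proof -
  have "A = c\<^sup>2 / (r * m\<^sup>2) * (a * P0)" unfolding A_eq by simp
  then show ?thesis unfolding aP0_eq using pos G_nz by (simp add: field_simps eval_nat_numeral)
qed

lemma Sigma_E: "\<Sigma> = (c * E * m * r\<^sup>2 / G)\<^sup>2"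
  unfolding Sigma_eq P0_eq using pos G_nz by (simp add: field_simps eval_nat_numeral)

text \<open>The assumption \<open>E * G > 0\<close> selects the branch of the root, and thereby the
  sign of \<open>Phi_fun\<close> in the angular equations.\<close>

lemma sqrt_Sigma: "sqrt \<Sigma> = c * E * m * r\<^sup>2 / G"
proof -
  have "c * E * m * r\<^sup>2 / G = c * m * r\<^sup>2 * (E * G) / G\<^sup>2"
    using G_nz by (simp add: power2_eq_square)
  also have "\<dots> > 0" using pos EG G_nz by simp
  finally show ?thesis unfolding Sigma_E real_sqrt_abs by (rule abs_of_pos)
qed

lemma D_eta: "D = eta_fun \<mu> m c E r / r^3"
proof -
  have "D = (G - 3 * \<mu> * A\<^sup>2) / r^3"
    unfolding D_def g_G using pos by (simp add: field_simps)
  also have "3 * \<mu> * A\<^sup>2 = 3 * \<mu> * c^4 * r^4 * E\<^sup>2 / G\<^sup>2"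
    unfolding A_E by (simp add: field_simps eval_nat_numeral)
  finally show ?thesis unfolding eta_fun_def G_def .
qed

text \<open>The mass relation solved for \<open>P1\<^sup>2\<close>, with \<open>\<Sigma>\<close> and
  \<open>P0\<close> inserted. It shows in turn that \<open>N_fun\<close> is nonnegative, so that its
  root is meaningful.\<close>

lemma P1_sq: "P1\<^sup>2 = m\<^sup>2 * N_fun \<mu> m c E r / G\<^sup>2"
proof -
  have a: "schw_a \<mu> r = a" by (simp add: schw_a_def a_eq)
  have "P1\<^sup>2 = a * (a * P0\<^sup>2 - \<Sigma> - m\<^sup>2)"
    unfolding mass[symmetric] using pos by (simp add: \<Sigma>_def field_simps)
  also have "\<dots> = m\<^sup>2 * N_fun \<mu> m c E r / G\<^sup>2"
    unfolding Sigma_E P0_eq N_fun_def a G_def[symmetric] using pos G_nz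
    by (simp add: field_simps eval_nat_numeral)
  finally show ?thesis .
qed

lemma N_fun_nonneg: "N_fun \<mu> m c E r \<ge> 0"
proof -
  have "N_fun \<mu> m c E r = P1\<^sup>2 * G\<^sup>2 / m\<^sup>2"
    unfolding P1_sq using pos G_nz by simp
  then show ?thesis by simp
qed

lemma P1_sqrt:
  obtains s where "s \<in> {1, - 1}" "P1 = s * (m * sqrt (N_fun \<mu> m c E r) / G)"
proof -
  have "P1\<^sup>2 = (m * sqrt (N_fun \<mu> m c E r) / G)\<^sup>2"
    using P1_sq N_fun_nonneg by (simp add: power_mult_distrib power_divide)
  then show ?thesis
    unfolding power2_eq_iff using that[of 1] that[of "- 1"] by auto
qed

lemma velocity_scale:
  assumes "eta_fun \<mu> m c E r \<noteq> 0" "D * z = g * m * Z"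
  shows "z = G * Z / (m * eta_fun \<mu> m c E r)"
  using assms pos unfolding D_eta g_G by (simp add: field_simps eval_nat_numeral)

lemma dt_scale:
  assumes "eta_fun \<mu> m c E r \<noteq> 0" "D * u0 = g * m * P0"
  shows "u0 = m * r^3 * E / (a * eta_fun \<mu> m c E r)"
  unfolding velocity_scale[OF assms] P0_eq using pos G_nz by (simp add: field_simps eval_nat_numeral)

text \<open>Dividing Z by the length of (X, Y) leaves a direction cosine; the length, an explicit
  function of r, is absorbed into \<open>Phi_fun\<close>.\<close>

lemma angular_scale:
  assumes "eta_fun \<mu> m c E r \<noteq> 0" "m * r * D * v = - (m\<^sup>2 + 2 * \<mu> * c\<^sup>2 / r^3) * Z"
  shows "v = Phi_fun \<mu> m c E r / eta_fun \<mu> m c E r * (Z / sqrt \<Sigma>)"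
proof -
  have "v = - (m\<^sup>2 * r^3 + 2 * \<mu> * c\<^sup>2) * Z / (m * r * eta_fun \<mu> m c E r)"
    using assms pos unfolding D_eta by (simp add: field_simps eval_nat_numeral)
  also have "\<dots> = Phi_fun \<mu> m c E r / eta_fun \<mu> m c E r * (Z / sqrt \<Sigma>)"
    unfolding sqrt_Sigma Phi_fun_def G_def[symmetric] using pos G_nz E_nz assms(1)
    by (simp add: divide_simps eval_nat_numeral) (simp add: algebra_simps)
  finally show ?thesis .
qed

end

end

section \<open>Observables in coordinate components\<close>

lemma lower_schwarzschild:
  "lower (schwarzschild \<mu>) y v $ 0 = - schw_a \<mu> (y $ 1) * v $ 0"
  "lower (schwarzschild \<mu>) y v $ 1 = v $ 1 / schw_a \<mu> (y $ 1)"
  "lower (schwarzschild \<mu>) y v $ 2 = (y $ 1)\<^sup>2 * v $ 2"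
  "lower (schwarzschild \<mu>) y v $ 3 = (y $ 1)\<^sup>2 * (sin (y $ 2))\<^sup>2 * v $ 3"
  by (simp_all add: lower_def matrix_vector_mult_def sum_4_from_0 schwarzschild_def)

lemma tetrad_inverse:
  assumes "\<mu> > 0" "y \<in> schw_exterior \<mu>"
  shows "matrix_inv (tetrad \<mu> y) = (\<chi> A \<alpha>. if A = \<alpha> then 1 / tetrad \<mu> y $ A $ A else 0)"
proof (rule matrix_inv_unique)
  have pos: "schw_a \<mu> (y $ 1) > 0" "y $ 1 > 0" "sin (y $ 2) \<noteq> 0"
    using assms by (auto simp: schw_exterior_def schw_a_pos)
  let ?D = "\<chi> \<alpha> \<beta>. if \<alpha> = \<beta> then 1 / tetrad \<mu> y $ \<alpha> $ \<alpha> else 0"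
  show "tetrad \<mu> y ** ?D = mat 1" "?D ** tetrad \<mu> y = mat 1"
    using pos unfolding vec_eq_iff forall_4_from_0
    by (simp_all add: tetrad_def matrix_matrix_mult_def mat_def sum_4_from_0)
qed

lemma tetrad_spin_component:
  assumes "\<mu> > 0" "y \<in> schw_exterior \<mu>"
  shows "tetrad_spin \<mu> y S $ A $ B = S $ A $ B / (tetrad \<mu> y $ A $ A * tetrad \<mu> y $ B $ B)"
proof -
  have "\<forall>A B. tetrad_spin \<mu> y S $ A $ B = S $ A $ B / (tetrad \<mu> y $ A $ A * tetrad \<mu> y $ B $ B)"
    unfolding forall_4_from_0 tetrad_spin_def tetrad_inverse[OF assms]
    by (simp add: matrix_matrix_mult_def transpose_def sum_4_from_0)
  then show ?thesis by blast
qed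

lemma spin_vector_components:
  assumes "\<mu> > 0" "y \<in> schw_exterior \<mu>"
  defines "r \<equiv> y $ 1" and "s \<equiv> sin (y $ 2)" and "a \<equiv> schw_a \<mu> (y $ 1)"
  shows "M_vec \<mu> y S $ 1 = S $ 0 $ 1"
    and "L_vec \<mu> y S $ 1 = S $ 2 $ 3 * r\<^sup>2 * s"
    and "L_vec \<mu> y S $ 2 = S $ 3 $ 1 * r * s / sqrt a"
    and "L_vec \<mu> y S $ 3 = S $ 1 $ 2 * r / sqrt a"
proof -
  have "a > 0"
    using assms by (auto simp: schw_exterior_def schw_a_pos a_def)
  then show "M_vec \<mu> y S $ 1 = S $ 0 $ 1" "L_vec \<mu> y S $ 1 = S $ 2 $ 3 * r\<^sup>2 * s"
    "L_vec \<mu> y S $ 2 = S $ 3 $ 1 * r * s / sqrt a" "L_vec \<mu> y S $ 3 = S $ 1 $ 2 * r / sqrt a"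
    by (simp_all add: M_vec_def L_vec_def Let_def vector_3 tetrad_spin_component[OF assms(1,2)]
        tetrad_def a_def r_def s_def power2_eq_square)
qed

text \<open>When \<open>P_phi\<close> vanishes, the first two components of Q are the pair (L1 / sin
  \<theta>, P_theta) rotated by the angle \<phi>, and a rotation is injective.\<close>

lemma total_angular_momentum_eq_0D:
  assumes "total_angular_momentum \<mu> y p S = 0" "sin (y $ 2) \<noteq> 0"
  shows "P_theta \<mu> y p S = 0" "L_vec \<mu> y S $ 1 = 0" "P_phi \<mu> y p S = 0"
proof -
  let ?s = "sin (y $ 3)" and ?c = "cos (y $ 3)"
    and ?L = "L_vec \<mu> y S $ 1 / sin (y $ 2)" and ?P = "P_theta \<mu> y p S"
  have *: "total_angular_momentum \<mu> y p S $ i = 0" for i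
    using assms(1) by simp
  show phi: "P_phi \<mu> y p S = 0"
    using *[of 3] by (simp add: total_angular_momentum_def Let_def vector_3)
  have 1: "?c * ?L - ?P * ?s = 0" and 2: "?s * ?L + ?P * ?c = 0"
    using *[of 1] *[of 2] phi by (simp_all add: total_angular_momentum_def Let_def vector_3)
  have "(?s\<^sup>2 + ?c\<^sup>2) * ?P = 0" "(?s\<^sup>2 + ?c\<^sup>2) * ?L = 0"
    using 1 2 by algebra+
  then show "?P = 0" "L_vec \<mu> y S $ 1 = 0"
    using assms(2) by simp_all
qed

text \<open>Passage from the geometric conditions at one instant to the algebraic locale. The roots
  of \<open>a\<close> in the tetrad components cancel against those in \<open>P_theta\<close> and
  \<open>P_phi\<close>.\<close>

lemma vanishing_Q_stateI:
  fixes y P :: "real^4" and W :: "real^4^4"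
  assumes "\<mu> > 0" "m > 0" "c > 0" "y \<in> schw_exterior \<mu>"
    and anti: "\<And>\<alpha> \<beta>. W $ \<beta> $ \<alpha> = - W $ \<alpha> $ \<beta>"
    and tul: "tulczyjew (schwarzschild \<mu>) y P W"
    and mass: "mass_sq (schwarzschild \<mu>) y P = m\<^sup>2"
    and spin: "spin_sq (schwarzschild \<mu>) y W = c\<^sup>2"
    and Q: "total_angular_momentum \<mu> y P W = 0"
  shows "y $ 1 * P $ 2 = - W $ 1 $ 2" "y $ 1 * P $ 3 = - W $ 1 $ 3" "W $ 2 $ 3 = 0"
    and "vanishing_Q_state \<mu> m c (y $ 1) (schw_a \<mu> (y $ 1)) (P $ 0) (P $ 1)
      (W $ 1 $ 2) (sin (y $ 2) * W $ 1 $ 3) (W $ 0 $ 1) (W $ 0 $ 2) (sin (y $ 2) * W $ 0 $ 3)"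
proof -
  define r s a where rsa: "r = y $ 1" "s = sin (y $ 2)" "a = schw_a \<mu> (y $ 1)"
  have "schw_a \<mu> r = a" by (simp add: rsa)
  note fold = rsa[symmetric] this
  have pos: "a > 0" "r > 0" "s \<noteq> 0"
    using assms(1,4) by (auto simp: schw_exterior_def schw_a_pos rsa)
  note obs = spin_vector_components[OF assms(1,4)] lower_schwarzschild
  have skew: "W $ 1 $ 0 = - W $ 0 $ 1" "W $ 2 $ 0 = - W $ 0 $ 2" "W $ 3 $ 0 = - W $ 0 $ 3"
    "W $ 2 $ 1 = - W $ 1 $ 2" "W $ 3 $ 1 = - W $ 1 $ 3" "W $ 3 $ 2 = - W $ 2 $ 3"
    by (rule anti)+
  have diag: "W $ \<alpha> $ \<alpha> = 0" for \<alpha>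
    using anti[of \<alpha> \<alpha>] by linarith
  note Q' = total_angular_momentum_eq_0D[OF Q pos(3)[unfolded rsa]]
  have "r * (r * P $ 2 + W $ 1 $ 2) = 0"
    using Q'(1) pos unfolding P_theta_def obs fold by (simp add: power2_eq_square algebra_simps)
  then have p2: "r * P $ 2 = - W $ 1 $ 2" using pos by simp
  show "W $ 2 $ 3 = 0" using Q'(2) pos unfolding obs fold by simp
  then have W23: "W $ 2 $ 3 = 0" .
  have "r * s\<^sup>2 * (r * P $ 3 + W $ 1 $ 3) = 0"
    using Q'(3) pos unfolding P_phi_def obs fold W23 skew by (simp add: power2_eq_square algebra_simps)
  then have p3: "r * P $ 3 = - W $ 1 $ 3" using pos by simp
  show "y $ 1 * P $ 2 = - W $ 1 $ 2" "y $ 1 * P $ 3 = - W $ 1 $ 3"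
    using p2 p3 by (simp_all add: rsa)
  \<comment> \<open>The factors are grouped so that \<open>p2\<close> and \<open>p3\<close> can be
    substituted. Components 1, 2, 3 become \<open>tul_A\<close>, \<open>tul_B\<close> and, after
    multiplication by s, \<open>tul_C\<close>.\<close>
  have T: "\<forall>\<alpha>. W $ \<alpha> $ 0 * (- a * P $ 0) + W $ \<alpha> $ 1 * (P $ 1 / a) + W $ \<alpha> $ 2 * (r * (r * P $ 2))
      + W $ \<alpha> $ 3 * (r * s\<^sup>2 * (r * P $ 3)) = 0"
    using tul unfolding tulczyjew_def sum_4_from_0 obs fold by (simp add: power2_eq_square algebra_simps)
  note T' = T[unfolded forall_4_from_0 p2 p3 skew diag W23]
  show "vanishing_Q_state \<mu> m c (y $ 1) (schw_a \<mu> (y $ 1)) (P $ 0) (P $ 1)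
      (W $ 1 $ 2) (sin (y $ 2) * W $ 1 $ 3) (W $ 0 $ 1) (W $ 0 $ 2) (sin (y $ 2) * W $ 0 $ 3)"
    unfolding fold
  proof
    show "\<mu> > 0" "m > 0" "c > 0" "r > 0" "a > 0" by (fact assms pos)+
    show "a = 1 - 2 * \<mu> / r" by (simp add: rsa schw_a_def)
    show "a * P $ 0 * W $ 0 $ 1 = r * ((W $ 1 $ 2)\<^sup>2 + (s * W $ 1 $ 3)\<^sup>2)"
      using T' by (simp add: power2_eq_square algebra_simps)
    show "a\<^sup>2 * P $ 0 * W $ 0 $ 2 = P $ 1 * W $ 1 $ 2"
      using T' pos by (simp add: power2_eq_square field_simps)
    have "a\<^sup>2 * P $ 0 * W $ 0 $ 3 = P $ 1 * W $ 1 $ 3"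
      using T' pos by (simp add: power2_eq_square field_simps)
    then show "a\<^sup>2 * P $ 0 * (s * W $ 0 $ 3) = P $ 1 * (s * W $ 1 $ 3)" by algebra
    have "m\<^sup>2 = a * (P $ 0)\<^sup>2 - (P $ 1)\<^sup>2 / a - ((r * P $ 2)\<^sup>2 + (s * (r * P $ 3))\<^sup>2)"
      using mass unfolding mass_sq_def sum_4_from_0 obs fold
      by (simp add: power2_eq_square algebra_simps)
    then show "a * (P $ 0)\<^sup>2 - (P $ 1)\<^sup>2 / a - ((W $ 1 $ 2)\<^sup>2 + (s * W $ 1 $ 3)\<^sup>2) = m\<^sup>2"
      unfolding p2 p3 by simp
    have "spin_sq (schwarzschild \<mu>) y W = - (W $ 0 $ 1)\<^sup>2 - a * r\<^sup>2 * ((W $ 0 $ 2)\<^sup>2 + (s * W $ 0 $ 3)\<^sup>2)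
        + r\<^sup>2 / a * ((W $ 1 $ 2)\<^sup>2 + (s * W $ 1 $ 3)\<^sup>2)"
      using pos unfolding spin_sq_def
      by (simp add: sum_4_from_0 schwarzschild_def fold skew diag W23 power2_eq_square field_simps)
    then show "- (W $ 0 $ 1)\<^sup>2 - a * r\<^sup>2 * ((W $ 0 $ 2)\<^sup>2 + (s * W $ 0 $ 3)\<^sup>2)
        + r\<^sup>2 / a * ((W $ 1 $ 2)\<^sup>2 + (s * W $ 1 $ 3)\<^sup>2) = c\<^sup>2"
      using spin by simp
  qed
qed

section \<open>Motions with vanishing total angular momentum\<close>

text \<open>The device that turns constraints into equations for the velocity: an identity may be
  differentiated because it holds in a neighbourhood of each instant.\<close>

lemma has_real_derivative_eq_on_open:
  fixes f g :: "real \<Rightarrow> real"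
  assumes "open I" "\<tau> \<in> I" "\<And>\<sigma>. \<sigma> \<in> I \<Longrightarrow> f \<sigma> = g \<sigma>"
    and "(f has_real_derivative a) (at \<tau>)" "(g has_real_derivative b) (at \<tau>)"
  shows "a = b"
  using has_field_derivative_transform_within_open[OF assms(4,1,2)] assms(3,5) DERIV_unique by blast

locale vanishing_Q_motion =
  fixes \<mu> m c :: real and I :: "real set" and y p :: "real \<Rightarrow> real^4" and S :: "real \<Rightarrow> real^4^4"
  assumes mu_pos: "\<mu> > 0" and m_pos: "m > 0" and c_pos: "c > 0"
    and interval: "open I" "is_interval I"
    and exterior: "\<And>\<tau>. \<tau> \<in> I \<Longrightarrow> y \<tau> $ 1 > 2 * \<mu>"
    and off_axis: "\<And>\<tau>. \<tau> \<in> I \<Longrightarrow> sin (y \<tau> $ 2) \<noteq> 0"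
    and motion: "mpd_motion (schwarzschild \<mu>) I y p S"
    and tul: "\<And>\<tau>. \<tau> \<in> I \<Longrightarrow> tulczyjew (schwarzschild \<mu>) (y \<tau>) (p \<tau>) (S \<tau>)"
    and mass: "\<And>\<tau>. \<tau> \<in> I \<Longrightarrow> mass_sq (schwarzschild \<mu>) (y \<tau>) (p \<tau>) = m\<^sup>2"
    and spin: "\<And>\<tau>. \<tau> \<in> I \<Longrightarrow> spin_sq (schwarzschild \<mu>) (y \<tau>) (S \<tau>) = c\<^sup>2"
    and param: "\<And>\<tau>. \<tau> \<in> I \<Longrightarrow> kinetic_mass (schwarzschild \<mu>) (y \<tau>) (p \<tau>) (velocity y \<tau>) = m"
    and Q_zero: "\<And>\<tau>. \<tau> \<in> I \<Longrightarrow> total_angular_momentum \<mu> (y \<tau>) (p \<tau>) (S \<tau>) = 0"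
begin

section \<open>State variables along a motion and their derivatives\<close>

definition "r \<tau> = y \<tau> $ 1"
definition "a \<tau> = schw_a \<mu> (y \<tau> $ 1)"
definition "sn \<tau> = sin (y \<tau> $ 2)"
definition "w \<tau> = cos (y \<tau> $ 2) * velocity y \<tau> $ 3"
definition "P0 \<tau> = p \<tau> $ 0"
definition "P1 \<tau> = p \<tau> $ 1"
definition "X \<tau> = S \<tau> $ 1 $ 2"
definition "Y \<tau> = sn \<tau> * S \<tau> $ 1 $ 3"
definition "A \<tau> = S \<tau> $ 0 $ 1"
definition "B \<tau> = S \<tau> $ 0 $ 2"
definition "C \<tau> = sn \<tau> * S \<tau> $ 0 $ 3"
definition "u0 \<tau> = velocity y \<tau> $ 0"
definition "u1 \<tau> = velocity y \<tau> $ 1"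
definition "v2 \<tau> = velocity y \<tau> $ 2"
definition "v3 \<tau> = sn \<tau> * velocity y \<tau> $ 3"

context
  fixes \<tau> :: real
  assumes \<tau>: "\<tau> \<in> I"
begin

lemma in_exterior: "y \<tau> \<in> schw_exterior \<mu>"
  using exterior off_axis \<tau> by (simp add: schw_exterior_def)

lemma sn_nz: "sn \<tau> \<noteq> 0"
  using off_axis \<tau> by (simp add: sn_def)

lemma skew: "S \<tau> $ \<beta> $ \<alpha> = - S \<tau> $ \<alpha> $ \<beta>"
  using motion \<tau> unfolding mpd_motion_def by blast

lemma state: "vanishing_Q_state \<mu> m c (r \<tau>) (a \<tau>) (P0 \<tau>) (P1 \<tau>) (X \<tau>) (Y \<tau>) (A \<tau>) (B \<tau>) (C \<tau>)"
  and P2_X: "r \<tau> * p \<tau> $ 2 = - X \<tau>"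
  and P3_Y: "r \<tau> * (sn \<tau> * p \<tau> $ 3) = - Y \<tau>"
  and S23: "S \<tau> $ 2 $ 3 = 0"
proof -
  note * = vanishing_Q_stateI[OF mu_pos m_pos c_pos in_exterior skew tul[OF \<tau>] mass[OF \<tau>] spin[OF \<tau>] Q_zero[OF \<tau>]]
  show "vanishing_Q_state \<mu> m c (r \<tau>) (a \<tau>) (P0 \<tau>) (P1 \<tau>) (X \<tau>) (Y \<tau>) (A \<tau>) (B \<tau>) (C \<tau>)"
    "r \<tau> * p \<tau> $ 2 = - X \<tau>" "S \<tau> $ 2 $ 3 = 0"
    using * by (simp_all add: r_def a_def sn_def P0_def P1_def X_def Y_def A_def B_def C_def)
  have "r \<tau> * (sn \<tau> * p \<tau> $ 3) = sn \<tau> * (y \<tau> $ 1 * p \<tau> $ 3)"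
    by (simp add: r_def)
  also have "\<dots> = - Y \<tau>"
    unfolding *(2) Y_def by simp
  finally show "r \<tau> * (sn \<tau> * p \<tau> $ 3) = - Y \<tau>" .
qed

lemma r_pos: "r \<tau> > 0" and a_pos: "a \<tau> > 0"
  using exterior[OF \<tau>] mu_pos by (auto simp: r_def a_def schw_a_pos)

lemma norm: "a \<tau> * P0 \<tau> * u0 \<tau> - P1 \<tau> * u1 \<tau> / a \<tau> + r \<tau> * (X \<tau> * v2 \<tau> + Y \<tau> * v3 \<tau>) = m"
proof -
  have "m = a \<tau> * P0 \<tau> * u0 \<tau> - P1 \<tau> * u1 \<tau> / a \<tau> - r \<tau> * ((r \<tau> * p \<tau> $ 2) * v2 \<tau>
      + (r \<tau> * (sn \<tau> * p \<tau> $ 3)) * v3 \<tau>)"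
    using param[OF \<tau>] unfolding kinetic_mass_def sum_4_from_0 lower_schwarzschild
    by (simp add: r_def a_def sn_def P0_def P1_def u0_def u1_def v2_def v3_def power2_eq_square algebra_simps)
  then show ?thesis unfolding P2_X P3_Y by (simp add: algebra_simps)
qed

lemmas comp = mpd_schwarzschild_components[of \<mu> y \<tau>, OF mu_pos in_exterior motion \<tau>,
    folded r_def a_def sn_def]

lemma DERIV_y: "((\<lambda>\<sigma>. y \<sigma> $ i) has_real_derivative velocity y \<tau> $ i) (at \<tau>)"
  by (rule comp(1))

lemma DERIV_r: "(r has_real_derivative u1 \<tau>) (at \<tau>)"
  using DERIV_y[of 1] by (simp add: r_def[abs_def] u1_def)

lemma DERIV_sn: "(sn has_real_derivative cos (y \<tau> $ 2) * v2 \<tau>) (at \<tau>)"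
  unfolding sn_def[abs_def] v2_def by (auto intro!: derivative_eq_intros DERIV_y)

lemma P2_div: "p \<tau> $ 2 = - X \<tau> / r \<tau>" and P3_div: "sn \<tau> * p \<tau> $ 3 = - Y \<tau> / r \<tau>"
  using P2_X P3_Y r_pos by (simp_all add: field_simps)

lemma DERIV_P1: "(P1 has_real_derivative
    - a \<tau> * \<mu> / (r \<tau>)\<^sup>2 * u0 \<tau> * P0 \<tau> + \<mu> / ((r \<tau>)\<^sup>2 * a \<tau>) * u1 \<tau> * P1 \<tau>
    - a \<tau> * (X \<tau> * v2 \<tau> + Y \<tau> * v3 \<tau>) - 2 * a \<tau> * \<mu> / (r \<tau>)^3 * u0 \<tau> * A \<tau>
    + \<mu> / r \<tau> * (X \<tau> * v2 \<tau> + Y \<tau> * v3 \<tau>)) (at \<tau>)"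
proof -
  have 1: "r \<tau> * a \<tau> * (velocity y \<tau> $ 2 * p \<tau> $ 2 + (sn \<tau>)\<^sup>2 * velocity y \<tau> $ 3 * p \<tau> $ 3)
      = - a \<tau> * (X \<tau> * v2 \<tau> + Y \<tau> * v3 \<tau>)"
  proof -
    have "r \<tau> * a \<tau> * (velocity y \<tau> $ 2 * p \<tau> $ 2 + (sn \<tau>)\<^sup>2 * velocity y \<tau> $ 3 * p \<tau> $ 3)
      = a \<tau> * (v2 \<tau> * (r \<tau> * p \<tau> $ 2) + v3 \<tau> * (r \<tau> * (sn \<tau> * p \<tau> $ 3)))"
      by (simp add: v2_def v3_def power2_eq_square algebra_simps)
    then show ?thesis unfolding P2_X P3_Y by (simp add: algebra_simps)
  qed
  have 2: "velocity y \<tau> $ 2 * S \<tau> $ 1 $ 2 + (sn \<tau>)\<^sup>2 * velocity y \<tau> $ 3 * S \<tau> $ 1 $ 3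
      = X \<tau> * v2 \<tau> + Y \<tau> * v3 \<tau>"
    by (simp add: v2_def v3_def X_def Y_def power2_eq_square algebra_simps)
  show ?thesis
    using comp(2) unfolding 1 2
    by (simp add: P0_def P1_def[abs_def] u0_def u1_def A_def)
qed

lemma DERIV_A: "(A has_real_derivative
    P0 \<tau> * u1 \<tau> - u0 \<tau> * P1 \<tau> + r \<tau> * a \<tau> * (v2 \<tau> * B \<tau> + v3 \<tau> * C \<tau>)) (at \<tau>)"
  using comp(3)
  by (simp add: A_def[abs_def] P0_def P1_def u0_def u1_def v2_def v3_def B_def C_def power2_eq_square algebra_simps)

lemma DERIV_B: "(B has_real_derivative P0 \<tau> * v2 \<tau> + u0 \<tau> * X \<tau> / r \<tau>
    - \<mu> / ((r \<tau>)\<^sup>2 * a \<tau>) * (u0 \<tau> * X \<tau> + u1 \<tau> * B \<tau>) - (u1 \<tau> * B \<tau> + v2 \<tau> * A \<tau>) / r \<tau>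
    + w \<tau> * C \<tau>) (at \<tau>)"
  using comp(4) unfolding P2_div
  by (simp add: A_def P0_def X_def u0_def u1_def v2_def B_def[abs_def] C_def w_def algebra_simps)

text \<open>The derivative of the factor sin \<theta> cancels the connection term in cot \<theta>
  d\<theta>/d\<tau>; what is left is the rotation by \<open>w\<close>. The same happens for
  \<open>Y\<close>.\<close>

lemma DERIV_C: "(C has_real_derivative P0 \<tau> * v3 \<tau> + u0 \<tau> * Y \<tau> / r \<tau>
    - \<mu> / ((r \<tau>)\<^sup>2 * a \<tau>) * (u0 \<tau> * Y \<tau> + u1 \<tau> * C \<tau>) - (u1 \<tau> * C \<tau> + v3 \<tau> * A \<tau>) / r \<tau>
    - w \<tau> * B \<tau>) (at \<tau>)"
proof -
  have *: "u0 \<tau> * Y \<tau> / r \<tau> = - (u0 \<tau> * (sn \<tau> * p \<tau> $ 3))"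
    unfolding P3_div by simp
  show ?thesis
    unfolding C_def[abs_def] *
    by (rule DERIV_cong[OF DERIV_mult[OF DERIV_sn comp(5)]])
       (use sn_nz r_pos a_pos in \<open>simp add: A_def P0_def Y_def u0_def u1_def v2_def v3_def B_def C_def w_def field_simps\<close>)
qed

lemma DERIV_X: "(X has_real_derivative P1 \<tau> * v2 \<tau> + u1 \<tau> * X \<tau> / r \<tau>
    - a \<tau> * \<mu> / (r \<tau>)\<^sup>2 * u0 \<tau> * B \<tau> + (\<mu> / ((r \<tau>)\<^sup>2 * a \<tau>) - 1 / r \<tau>) * u1 \<tau> * X \<tau>
    + w \<tau> * Y \<tau>) (at \<tau>)"
  using comp(6) unfolding P2_div S23
  by (simp add: P1_def X_def[abs_def] Y_def u0_def u1_def v2_def B_def w_def algebra_simps)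

lemma DERIV_Y: "(Y has_real_derivative P1 \<tau> * v3 \<tau> + u1 \<tau> * Y \<tau> / r \<tau>
    - a \<tau> * \<mu> / (r \<tau>)\<^sup>2 * u0 \<tau> * C \<tau> + (\<mu> / ((r \<tau>)\<^sup>2 * a \<tau>) - 1 / r \<tau>) * u1 \<tau> * Y \<tau>
    - w \<tau> * X \<tau>) (at \<tau>)"
proof -
  have *: "u1 \<tau> * Y \<tau> / r \<tau> = - (u1 \<tau> * (sn \<tau> * p \<tau> $ 3))"
    unfolding P3_div by simp
  show ?thesis
    unfolding * unfolding Y_def[abs_def]
    by (rule DERIV_cong[OF DERIV_mult[OF DERIV_sn comp(7)]])
       (use sn_nz r_pos a_pos in \<open>simp add: P1_def X_def Y_def u0_def u1_def v2_def v3_def C_def w_def S23 field_simps\<close>)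
qed

end

section \<open>Velocity components along the motion\<close>

lemma transverse:
  assumes "\<tau> \<in> I"
  shows "X \<tau> * v3 \<tau> = Y \<tau> * v2 \<tau>"
proof -
  interpret vanishing_Q_state \<mu> m c "r \<tau>" "a \<tau>" "P0 \<tau>" "P1 \<tau>" "X \<tau>" "Y \<tau>" "A \<tau>" "B \<tau>" "C \<tau>"
    by (rule state[OF assms])
  have "B \<sigma> * Y \<sigma> = C \<sigma> * X \<sigma>" if "\<sigma> \<in> I" for \<sigma>
    using vanishing_Q_state.B_eq[OF state[OF that]] vanishing_Q_state.C_eq[OF state[OF that]] by simp
  \<comment> \<open>Stated for arbitrary derivative values, so that the long right-hand sides enter
    only by unification.\<close>
  then have "B' * Y \<tau> + B \<tau> * Y' = C' * X \<tau> + C \<tau> * X'"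
    if "(B has_real_derivative B') (at \<tau>)" "(C has_real_derivative C') (at \<tau>)"
      "(X has_real_derivative X') (at \<tau>)" "(Y has_real_derivative Y') (at \<tau>)" for B' C' X' Y'
    using has_real_derivative_eq_on_open[OF interval(1) assms _ DERIV_mult[OF that(1,4)]
        DERIV_mult[OF that(2,3)]] by (simp add: ac_simps)
  from this[OF DERIV_B DERIV_C DERIV_X DERIV_Y, OF assms assms assms assms]
  show ?thesis by (rule transverse_velocity[rotated 4]) (rule refl)+
qed

lemma time:
  assumes "\<tau> \<in> I"
  shows "vanishing_Q_state.D \<mu> m c (r \<tau>) (A \<tau>) * u0 \<tau> = vanishing_Q_state.g \<mu> m c (r \<tau>) * m * P0 \<tau>"
proof -
  interpret vanishing_Q_state \<mu> m c "r \<tau>" "a \<tau>" "P0 \<tau>" "P1 \<tau>" "X \<tau>" "Y \<tau>" "A \<tau>" "B \<tau>" "C \<tau>"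
    by (rule state[OF assms])
  \<comment> \<open>The time component of the Tulczyjew condition, recovered from the other three.
    Writing r a as r - 2 \<mu> makes its derivative that of r.\<close>
  have prod: "A \<sigma> * P1 \<sigma> = (r \<sigma> - 2 * \<mu>) * (B \<sigma> * X \<sigma> + C \<sigma> * Y \<sigma>)" if "\<sigma> \<in> I" for \<sigma>
  proof -
    interpret s: vanishing_Q_state \<mu> m c "r \<sigma>" "a \<sigma>" "P0 \<sigma>" "P1 \<sigma>" "X \<sigma>" "Y \<sigma>" "A \<sigma>" "B \<sigma>" "C \<sigma>"
      by (rule state[OF that])
    have "B \<sigma> * X \<sigma> + C \<sigma> * Y \<sigma> = P1 \<sigma> / ((a \<sigma>)\<^sup>2 * P0 \<sigma>) * s.\<Sigma>"
      unfolding s.B_eq s.C_eq s.b_def s.\<Sigma>_def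
      by (simp add: power2_eq_square algebra_simps add_divide_distrib)
    moreover have "A \<sigma> * P1 \<sigma> = r \<sigma> * a \<sigma> * (P1 \<sigma> / ((a \<sigma>)\<^sup>2 * P0 \<sigma>) * s.\<Sigma>)"
      unfolding s.A_Sigma using s.P0_nz s.pos by (simp add: field_simps power2_eq_square)
    moreover have "r \<sigma> - 2 * \<mu> = r \<sigma> * a \<sigma>"
      using s.a_eq s.pos by (simp add: field_simps)
    ultimately show ?thesis by simp
  qed
  have "A' * P1 \<tau> + A \<tau> * P1' = u1 \<tau> * (B \<tau> * X \<tau> + C \<tau> * Y \<tau>)
      + r \<tau> * a \<tau> * (B' * X \<tau> + B \<tau> * X' + C' * Y \<tau> + C \<tau> * Y')"
    if "(A has_real_derivative A') (at \<tau>)" "(P1 has_real_derivative P1') (at \<tau>)"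
      "(B has_real_derivative B') (at \<tau>)" "(C has_real_derivative C') (at \<tau>)"
      "(X has_real_derivative X') (at \<tau>)" "(Y has_real_derivative Y') (at \<tau>)" for A' P1' B' C' X' Y'
  proof -
    have a_r: "r \<tau> - 2 * \<mu> = r \<tau> * a \<tau>"
      using a_eq pos by (simp add: field_simps)
    have "((\<lambda>\<sigma>. (r \<sigma> - 2 * \<mu>) * (B \<sigma> * X \<sigma> + C \<sigma> * Y \<sigma>)) has_real_derivative
      u1 \<tau> * (B \<tau> * X \<tau> + C \<tau> * Y \<tau>) + (r \<tau> - 2 * \<mu>) * (B' * X \<tau> + B \<tau> * X' + C' * Y \<tau> + C \<tau> * Y')) (at \<tau>)"
      by (auto intro!: derivative_eq_intros DERIV_r[OF assms] that simp: algebra_simps)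
    from has_real_derivative_eq_on_open[OF interval(1) assms prod DERIV_mult[OF that(1,2)] this]
    show ?thesis unfolding a_r by (simp add: ac_simps)
  qed
  from this[OF DERIV_A DERIV_P1 DERIV_B DERIV_C DERIV_X DERIV_Y, OF assms assms assms assms assms assms]
  show ?thesis
    by (rule time_velocity[OF _ _ _ _ _ _ _ norm[OF assms], rotated 6]) (rule refl)+
qed

text \<open>Constancy of the energy turns \<open>a * P0\<close> in \<open>tul_A\<close> into
  \<open>E + \<mu> / r\<^sup>2 * A\<close>, so that differentiating it requires no derivative of
  \<open>P0\<close>.\<close>

lemma radial:
  assumes "\<tau> \<in> I" and E: "\<And>\<sigma>. \<sigma> \<in> I \<Longrightarrow> E = a \<sigma> * P0 \<sigma> - \<mu> / (r \<sigma>)\<^sup>2 * A \<sigma>"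
  shows "vanishing_Q_state.D \<mu> m c (r \<tau>) (A \<tau>) * u1 \<tau> = vanishing_Q_state.g \<mu> m c (r \<tau>) * m * P1 \<tau>"
proof -
  interpret vanishing_Q_state \<mu> m c "r \<tau>" "a \<tau>" "P0 \<tau>" "P1 \<tau>" "X \<tau>" "Y \<tau>" "A \<tau>" "B \<tau>" "C \<tau>"
    by (rule state[OF assms(1)])
  let ?A' = "P0 \<tau> * u1 \<tau> - u0 \<tau> * P1 \<tau> + r \<tau> * a \<tau> * (v2 \<tau> * B \<tau> + v3 \<tau> * C \<tau>)"
  have eq: "(E + \<mu> / (r \<sigma>)\<^sup>2 * A \<sigma>) * A \<sigma> = r \<sigma> * ((X \<sigma>)\<^sup>2 + (Y \<sigma>)\<^sup>2)" if "\<sigma> \<in> I" for \<sigma>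
    using vanishing_Q_state.tul_A[OF state[OF that]] E[OF that] by simp
  have inner: "((\<lambda>\<sigma>. E + \<mu> / (r \<sigma>)\<^sup>2 * A \<sigma>) has_real_derivative
      \<mu> / (r \<tau>)\<^sup>2 * A' - 2 * \<mu> / (r \<tau>)^3 * u1 \<tau> * A \<tau>) (at \<tau>)"
    if "(A has_real_derivative A') (at \<tau>)" for A'
    using pos by (auto intro!: derivative_eq_intros DERIV_r[OF assms(1)] that
        simp: field_simps eval_nat_numeral)
  have lhs: "((\<lambda>\<sigma>. (E + \<mu> / (r \<sigma>)\<^sup>2 * A \<sigma>) * A \<sigma>) has_real_derivative
      (\<mu> / (r \<tau>)\<^sup>2 * ?A' - 2 * \<mu> / (r \<tau>)^3 * u1 \<tau> * A \<tau>) * A \<tau> + a \<tau> * P0 \<tau> * ?A') (at \<tau>)"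
    by (rule DERIV_cong[OF DERIV_mult[OF inner[OF DERIV_A[OF assms(1)]] DERIV_A[OF assms(1)]]])
       (simp add: E[OF assms(1)])
  have rhs: "((\<lambda>\<sigma>. r \<sigma> * ((X \<sigma>)\<^sup>2 + (Y \<sigma>)\<^sup>2)) has_real_derivative
      u1 \<tau> * ((X \<tau>)\<^sup>2 + (Y \<tau>)\<^sup>2) + r \<tau> * (2 * X \<tau> * X' + 2 * Y \<tau> * Y')) (at \<tau>)"
    if "(X has_real_derivative X') (at \<tau>)" "(Y has_real_derivative Y') (at \<tau>)" for X' Y'
    by (auto intro!: derivative_eq_intros DERIV_r[OF assms(1)] that simp: algebra_simps)
  show ?thesis
    by (rule radial_velocity[OF refl refl refl _ norm[OF assms(1)]])
       (rule has_real_derivative_eq_on_open[OF interval(1) assms(1) eq lhs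
          rhs[OF DERIV_X[OF assms(1)] DERIV_Y[OF assms(1)]]])
qed

section \<open>The constant of the motion K\<close>

lemma K_eq:
  assumes "\<tau> \<in> I"
  shows "K_fun \<mu> (y \<tau>) (S \<tau>) = - (Y \<tau> * sn \<tau> / sqrt ((X \<tau>)\<^sup>2 + (Y \<tau>)\<^sup>2))"
proof -
  note L = spin_vector_components(3,4)[OF mu_pos in_exterior[OF assms], of "S \<tau>",
      folded r_def a_def sn_def]
  define q where "q = r \<tau> / sqrt (a \<tau>)"
  have q: "q > 0" using r_pos[OF assms] a_pos[OF assms] by (simp add: q_def)
  have "L_vec \<mu> (y \<tau>) (S \<tau>) $ 2 = - q * Y \<tau>" "L_vec \<mu> (y \<tau>) (S \<tau>) $ 3 = q * X \<tau>"
    unfolding L using skew[OF assms, of 3 1] by (simp_all add: q_def X_def Y_def)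
  moreover have "sqrt ((- q * Y \<tau>)\<^sup>2 + (q * X \<tau>)\<^sup>2) = q * sqrt ((X \<tau>)\<^sup>2 + (Y \<tau>)\<^sup>2)"
  proof -
    have "(- q * Y \<tau>)\<^sup>2 + (q * X \<tau>)\<^sup>2 = q\<^sup>2 * ((X \<tau>)\<^sup>2 + (Y \<tau>)\<^sup>2)"
      by (simp add: power2_eq_square algebra_simps)
    then show ?thesis using q by (simp add: real_sqrt_mult)
  qed
  ultimately show ?thesis
    unfolding K_fun_def sn_def using q by simp
qed

text \<open>Let R be the length of (X, Y). Terms of the spin equation along (X, Y) change only R.
  The rotation by \<open>w\<close> changes Y / R, and this balances the change of sin \<theta>
  because (v2, v3) is parallel to (X, Y). The result has the form of Clairaut's relation for great
  circles.\<close>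

lemma K_constant: "\<exists>\<kappa>. \<forall>\<tau>\<in>I. K_fun \<mu> (y \<tau>) (S \<tau>) = \<kappa>"
proof -
  let ?K = "\<lambda>\<sigma>. Y \<sigma> * sn \<sigma> / sqrt ((X \<sigma>)\<^sup>2 + (Y \<sigma>)\<^sup>2)"
  have deriv: "(?K has_real_derivative 0) (at \<tau>)" if \<tau>: "\<tau> \<in> I" for \<tau>
  proof -
    interpret vanishing_Q_state \<mu> m c "r \<tau>" "a \<tau>" "P0 \<tau>" "P1 \<tau>" "X \<tau>" "Y \<tau>" "A \<tau>" "B \<tau>" "C \<tau>"
      by (rule state[OF \<tau>])
    define X' where "X' = P1 \<tau> * v2 \<tau> + u1 \<tau> * X \<tau> / r \<tau>
      - a \<tau> * \<mu> / (r \<tau>)\<^sup>2 * u0 \<tau> * B \<tau> + (\<mu> / ((r \<tau>)\<^sup>2 * a \<tau>) - 1 / r \<tau>) * u1 \<tau> * X \<tau> + w \<tau> * Y \<tau>"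
    define Y' where "Y' = P1 \<tau> * v3 \<tau> + u1 \<tau> * Y \<tau> / r \<tau>
      - a \<tau> * \<mu> / (r \<tau>)\<^sup>2 * u0 \<tau> * C \<tau> + (\<mu> / ((r \<tau>)\<^sup>2 * a \<tau>) - 1 / r \<tau>) * u1 \<tau> * Y \<tau> - w \<tau> * X \<tau>"
    have DX: "(X has_real_derivative X') (at \<tau>)" and DY: "(Y has_real_derivative Y') (at \<tau>)"
      unfolding X'_def Y'_def by (rule DERIV_X[OF \<tau>] DERIV_Y[OF \<tau>])+
    define R where "R = sqrt \<Sigma>"
    have R: "R > 0" "R\<^sup>2 = (X \<tau>)\<^sup>2 + (Y \<tau>)\<^sup>2" "sqrt ((X \<tau>)\<^sup>2 + (Y \<tau>)\<^sup>2) = R"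
      using Sigma_pos by (simp_all add: R_def \<Sigma>_def)
    have "X \<tau> * Y' - Y \<tau> * X' = P1 \<tau> * (X \<tau> * v3 \<tau> - Y \<tau> * v2 \<tau>) - w \<tau> * ((X \<tau>)\<^sup>2 + (Y \<tau>)\<^sup>2)"
      unfolding X'_def Y'_def B_eq C_eq by (simp add: power2_eq_square algebra_simps)
    then have XY: "X \<tau> * Y' - Y \<tau> * X' = - w \<tau> * R\<^sup>2"
      using transverse[OF \<tau>] R by simp
    \<comment> \<open>Parallelism multiplied by cos \<theta>; this is the cancellation on which the
      vanishing derivative rests.\<close>
    have w_v2: "X \<tau> * (w \<tau> * sn \<tau>) = Y \<tau> * (cos (y \<tau> $ 2) * v2 \<tau>)"
      using transverse[OF \<tau>] by (simp add: w_def v3_def algebra_simps)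
    have DK: "(?K has_real_derivative
        ((Y' * sn \<tau> + cos (y \<tau> $ 2) * v2 \<tau> * Y \<tau>) * R - Y \<tau> * sn \<tau> * ((X \<tau> * X' + Y \<tau> * Y') / R)) / R\<^sup>2) (at \<tau>)"
    proof -
      have S: "((\<lambda>\<sigma>. sqrt ((X \<sigma>)\<^sup>2 + (Y \<sigma>)\<^sup>2)) has_real_derivative (X \<tau> * X' + Y \<tau> * Y') / R) (at \<tau>)"
      proof -
        have "((\<lambda>\<sigma>. (X \<sigma>)\<^sup>2 + (Y \<sigma>)\<^sup>2) has_real_derivative 2 * (X \<tau> * X' + Y \<tau> * Y')) (at \<tau>)"
          by (auto intro!: derivative_eq_intros DX DY)
        note inner = this
        have "((\<lambda>\<sigma>. sqrt ((X \<sigma>)\<^sup>2 + (Y \<sigma>)\<^sup>2)) has_real_derivative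
            inverse (sqrt ((X \<tau>)\<^sup>2 + (Y \<tau>)\<^sup>2)) / 2 * (2 * (X \<tau> * X' + Y \<tau> * Y'))) (at \<tau>)"
          using Sigma_pos by (intro DERIV_chain2[OF DERIV_real_sqrt inner]) (simp add: \<Sigma>_def)
        then show ?thesis
          by (rule DERIV_cong) (use R in \<open>simp add: field_simps\<close>)
      qed
      show ?thesis
        by (rule DERIV_cong[OF DERIV_divide[OF DERIV_mult[OF DY DERIV_sn[OF \<tau>]] S]])
           (use R in \<open>auto simp: power2_eq_square\<close>)
    qed
    have "(Y' * sn \<tau> + cos (y \<tau> $ 2) * v2 \<tau> * Y \<tau>) * R - Y \<tau> * sn \<tau> * ((X \<tau> * X' + Y \<tau> * Y') / R)
      = (sn \<tau> * (Y' * (R\<^sup>2 - (Y \<tau>)\<^sup>2) - Y \<tau> * X \<tau> * X') + cos (y \<tau> $ 2) * v2 \<tau> * Y \<tau> * R\<^sup>2) / R"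
      using R(1) by (simp add: field_simps power2_eq_square)
    also have "Y' * (R\<^sup>2 - (Y \<tau>)\<^sup>2) - Y \<tau> * X \<tau> * X' = X \<tau> * (X \<tau> * Y' - Y \<tau> * X')"
      unfolding R by (simp add: power2_eq_square algebra_simps)
    also have "\<dots> = - (X \<tau> * w \<tau> * R\<^sup>2)"
      unfolding XY by simp
    also have "sn \<tau> * - (X \<tau> * w \<tau> * R\<^sup>2) + cos (y \<tau> $ 2) * v2 \<tau> * Y \<tau> * R\<^sup>2 =
        R\<^sup>2 * (Y \<tau> * (cos (y \<tau> $ 2) * v2 \<tau>) - X \<tau> * (w \<tau> * sn \<tau>))"
      by (simp add: algebra_simps)
    finally show ?thesis using DK unfolding w_v2 by simp
  qed
  have "convex I" by (rule is_interval_convex[OF interval(2)])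
  then have "\<exists>k. \<forall>\<tau>\<in>I. ?K \<tau> = k"
    by (rule has_field_derivative_zero_constant[OF _ has_field_derivative_at_within[OF deriv]])
  then obtain k where k: "\<forall>\<tau>\<in>I. ?K \<tau> = k" ..
  have "\<forall>\<tau>\<in>I. K_fun \<mu> (y \<tau>) (S \<tau>) = - k"
  proof
    fix \<tau> assume \<tau>: "\<tau> \<in> I"
    show "K_fun \<mu> (y \<tau>) (S \<tau>) = - k"
      unfolding K_eq[OF \<tau>] bspec[OF k \<tau>] ..
  qed
  then show ?thesis ..
qed

section \<open>The quadratures\<close>

context
  fixes E :: real
  assumes E: "\<And>\<tau>. \<tau> \<in> I \<Longrightarrow> E = - P_t \<mu> (y \<tau>) (p \<tau>) (S \<tau>)"
    and E_pos: "\<And>\<tau>. \<tau> \<in> I \<Longrightarrow> E * (m\<^sup>2 * (y \<tau> $ 1)^3 - \<mu> * c\<^sup>2) > 0"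
    and eta_nz: "\<And>\<tau>. \<tau> \<in> I \<Longrightarrow> eta_fun \<mu> m c E (y \<tau> $ 1) \<noteq> 0"
begin

lemma energy: "\<tau> \<in> I \<Longrightarrow> E = a \<tau> * P0 \<tau> - \<mu> / (r \<tau>)\<^sup>2 * A \<tau>"
  using spin_vector_components(1)[OF mu_pos in_exterior, of \<tau>]
  by (simp add: E P_t_def lower_schwarzschild a_def P0_def r_def A_def)

context
  fixes \<tau> :: real
  assumes \<tau>: "\<tau> \<in> I"
begin

interpretation vanishing_Q_state \<mu> m c "r \<tau>" "a \<tau>" "P0 \<tau>" "P1 \<tau>" "X \<tau>" "Y \<tau>" "A \<tau>" "B \<tau>" "C \<tau>"
  by (rule state[OF \<tau>])

lemmas E_state = energy[OF \<tau>] E_pos[OF \<tau>, folded r_def]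

lemma eta_nz': "eta_fun \<mu> m c E (r \<tau>) \<noteq> 0"
  using eta_nz[OF \<tau>] by (simp add: r_def)

lemma time_quadrature: "u0 \<tau> = m * (r \<tau>)^3 * E / (a \<tau> * eta_fun \<mu> m c E (r \<tau>))"
  by (rule dt_scale[OF E_state eta_nz' time[OF \<tau>]])

lemma angular_quadrature:
  "v2 \<tau> = Phi_fun \<mu> m c E (r \<tau>) / eta_fun \<mu> m c E (r \<tau>) * (X \<tau> / sqrt ((X \<tau>)\<^sup>2 + (Y \<tau>)\<^sup>2))"
  "v3 \<tau> = Phi_fun \<mu> m c E (r \<tau>) / eta_fun \<mu> m c E (r \<tau>) * (Y \<tau> / sqrt ((X \<tau>)\<^sup>2 + (Y \<tau>)\<^sup>2))"
  using tangential_velocity[OF radial[OF \<tau> energy] time[OF \<tau>] transverse[OF \<tau>] norm[OF \<tau>]]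
    angular_scale[OF E_state eta_nz'] unfolding \<Sigma>_def by blast+

text \<open>\<open>P_r\<close> and dr/d\<tau> are both multiples of \<open>P1\<close>, so the sign
  of its root is shared.\<close>

lemma radial_quadrature:
  obtains s where "s \<in> {1, - 1}"
    "P_r \<mu> (y \<tau>) (p \<tau>) =
      s * (m * sqrt (N_fun \<mu> m c E (r \<tau>)) / (a \<tau> * (m\<^sup>2 * (r \<tau>)^3 - \<mu> * c\<^sup>2)))"
    "u1 \<tau> = s * (sqrt (N_fun \<mu> m c E (r \<tau>)) / eta_fun \<mu> m c E (r \<tau>))"
proof -
  obtain s where s: "s \<in> {1, - 1}" "P1 \<tau> = s * (m * sqrt (N_fun \<mu> m c E (r \<tau>)) / G)"
    using P1_sqrt[OF E_state] by blast
  have "P_r \<mu> (y \<tau>) (p \<tau>) = P1 \<tau> / a \<tau>"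
    by (simp add: P_r_def lower_schwarzschild P1_def a_def)
  moreover have "u1 \<tau> = G * P1 \<tau> / (m * eta_fun \<mu> m c E (r \<tau>))"
    by (rule velocity_scale[OF E_state eta_nz' radial[OF \<tau> energy]])
  ultimately have "P_r \<mu> (y \<tau>) (p \<tau>) = s * (m * sqrt (N_fun \<mu> m c E (r \<tau>)) / (a \<tau> * G))"
    "u1 \<tau> = s * (sqrt (N_fun \<mu> m c E (r \<tau>)) / eta_fun \<mu> m c E (r \<tau>))"
    using pos G_nz[OF E_state] unfolding s(2) by (simp_all add: ac_simps)
  then show ?thesis
    using that[OF s(1)] unfolding G_def by blast
qed

lemma N_nonneg: "N_fun \<mu> m c E (r \<tau>) \<ge> 0"
  by (rule N_fun_nonneg[OF E_state])

lemma azimuth_quadrature: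
  assumes "K_fun \<mu> (y \<tau>) (S \<tau>) = \<kappa>"
  shows "velocity y \<tau> $ 3 =
    - (\<kappa> * Phi_fun \<mu> m c E (r \<tau>) / (eta_fun \<mu> m c E (r \<tau>) * (sn \<tau>)\<^sup>2))"
proof -
  have "velocity y \<tau> $ 3 = v3 \<tau> / sn \<tau>"
    using sn_nz[OF \<tau>] by (simp add: v3_def)
  then show ?thesis
    unfolding angular_quadrature assms[symmetric] K_eq[OF \<tau>] using sn_nz[OF \<tau>]
    by (simp add: power2_eq_square[of "sn \<tau>"] mult_ac)
qed

text \<open>By \<open>K_eq\<close> the quotient is the squared direction cosine Y / R, and its
  complement to 1 is that of X. The root therefore recovers X / R up to the sign of X, which is the
  sign of L3.\<close>

lemma polar_quadrature:
  assumes "K_fun \<mu> (y \<tau>) (S \<tau>) = \<kappa>"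
  shows "\<kappa>\<^sup>2 / (sn \<tau>)\<^sup>2 \<le> 1"
    and "\<exists>s\<in>{1, - 1}. (L_vec \<mu> (y \<tau>) (S \<tau>) $ 3 > 0 \<longrightarrow> s = 1) \<and> (L_vec \<mu> (y \<tau>) (S \<tau>) $ 3 < 0 \<longrightarrow> s = - 1) \<and>
      v2 \<tau> = s * (Phi_fun \<mu> m c E (r \<tau>) / eta_fun \<mu> m c E (r \<tau>) * sqrt (1 - \<kappa>\<^sup>2 / (sn \<tau>)\<^sup>2))"
proof -
  define R where "R = sqrt ((X \<tau>)\<^sup>2 + (Y \<tau>)\<^sup>2)"
  have R: "R > 0" "R\<^sup>2 = (X \<tau>)\<^sup>2 + (Y \<tau>)\<^sup>2"
    using Sigma_pos by (simp_all add: R_def \<Sigma>_def)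
  have \<kappa>: "\<kappa>\<^sup>2 / (sn \<tau>)\<^sup>2 = (Y \<tau>)\<^sup>2 / R\<^sup>2"
    unfolding assms[symmetric] K_eq[OF \<tau>] R_def[symmetric] using sn_nz[OF \<tau>]
    by (simp add: power_mult_distrib power_divide)
  show "\<kappa>\<^sup>2 / (sn \<tau>)\<^sup>2 \<le> 1"
    unfolding \<kappa> using R(1) by (simp add: divide_le_eq_1_pos) (simp add: R(2))
  have "1 - \<kappa>\<^sup>2 / (sn \<tau>)\<^sup>2 = (X \<tau> / R)\<^sup>2"
  proof -
    have "(X \<tau>)\<^sup>2 = R\<^sup>2 - (Y \<tau>)\<^sup>2" using R by simp
    then show ?thesis unfolding \<kappa> using R(1) by (simp add: power_divide diff_divide_distrib)
  qed
  then have root: "sqrt (1 - \<kappa>\<^sup>2 / (sn \<tau>)\<^sup>2) = \<bar>X \<tau>\<bar> / R"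
    using R by simp
  \<comment> \<open>At X = 0 the root vanishes and either sign would do; 1 is chosen.\<close>
  define s :: real where "s = (if X \<tau> < 0 then - 1 else 1)"
  define q where "q = r \<tau> / sqrt (a \<tau>)"
  have "q > 0" using pos by (simp add: q_def)
  moreover have "L_vec \<mu> (y \<tau>) (S \<tau>) $ 3 = X \<tau> * q"
    using spin_vector_components(4)[OF mu_pos in_exterior[OF \<tau>]]
    by (simp add: X_def r_def a_def q_def)
  ultimately have "L_vec \<mu> (y \<tau>) (S \<tau>) $ 3 > 0 \<longrightarrow> s = 1" "L_vec \<mu> (y \<tau>) (S \<tau>) $ 3 < 0 \<longrightarrow> s = - 1"
    by (auto simp: s_def zero_less_mult_iff mult_less_0_iff)
  moreover have "v2 \<tau> = s * (Phi_fun \<mu> m c E (r \<tau>) / eta_fun \<mu> m c E (r \<tau>) * sqrt (1 - \<kappa>\<^sup>2 / (sn \<tau>)\<^sup>2))"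
    unfolding angular_quadrature root R_def[symmetric] by (simp add: s_def)
  ultimately show "\<exists>s\<in>{1, - 1}. (L_vec \<mu> (y \<tau>) (S \<tau>) $ 3 > 0 \<longrightarrow> s = 1) \<and>
      (L_vec \<mu> (y \<tau>) (S \<tau>) $ 3 < 0 \<longrightarrow> s = - 1) \<and>
      v2 \<tau> = s * (Phi_fun \<mu> m c E (r \<tau>) / eta_fun \<mu> m c E (r \<tau>) * sqrt (1 - \<kappa>\<^sup>2 / (sn \<tau>)\<^sup>2))"
    by (intro bexI[of _ s]) (auto simp: s_def)
qed

end

end

end

theorem mainTheorem4:
  fixes \<mu> m c :: real
    and I :: "real set"
    and y p :: "real \<Rightarrow> real^4"
    and S :: "real \<Rightarrow> real^4^4"
  assumes mu_pos: "\<mu> > 0" and m_pos: "m > 0" and c_pos: "c > 0"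
    and interval: "open I" "is_interval I"
    and exterior: "\<And>\<tau>. \<tau> \<in> I \<Longrightarrow> y \<tau> $ 1 > 2 * \<mu>"
    and off_axis: "\<And>\<tau>. \<tau> \<in> I \<Longrightarrow> sin (y \<tau> $ 2) \<noteq> 0"
    and motion: "mpd_motion (schwarzschild \<mu>) I y p S"
    and tul: "\<And>\<tau>. \<tau> \<in> I \<Longrightarrow> tulczyjew (schwarzschild \<mu>) (y \<tau>) (p \<tau>) (S \<tau>)"
    and mass: "\<And>\<tau>. \<tau> \<in> I \<Longrightarrow> mass_sq (schwarzschild \<mu>) (y \<tau>) (p \<tau>) = m\<^sup>2"
    and spin: "\<And>\<tau>. \<tau> \<in> I \<Longrightarrow> spin_sq (schwarzschild \<mu>) (y \<tau>) (S \<tau>) = c\<^sup>2"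
    and param: "\<And>\<tau>. \<tau> \<in> I \<Longrightarrow> kinetic_mass (schwarzschild \<mu>) (y \<tau>) (p \<tau>) (velocity y \<tau>) = m"
    and nondeg: "\<And>\<tau>. \<tau> \<in> I \<Longrightarrow> d_scalar (schwarzschild \<mu>) (y \<tau>) (S \<tau>) \<noteq> 2 * m\<^sup>2"
    and Q_zero: "\<And>\<tau>. \<tau> \<in> I \<Longrightarrow> total_angular_momentum \<mu> (y \<tau>) (p \<tau>) (S \<tau>) = 0"
  shows
    "(\<forall>\<tau>\<in>I. P_theta \<mu> (y \<tau>) (p \<tau>) (S \<tau>) = 0 \<and> L_vec \<mu> (y \<tau>) (S \<tau>) $ 1 = 0
        \<and> P_phi \<mu> (y \<tau>) (p \<tau>) (S \<tau>) = 0) \<and>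
     (\<forall>\<E>::real.
        (\<forall>\<tau>\<in>I. \<E> = - P_t \<mu> (y \<tau>) (p \<tau>) (S \<tau>)
           \<and> \<E> * (m\<^sup>2 * (y \<tau> $ 1)^3 - \<mu> * c\<^sup>2) > 0
           \<and> eta_fun \<mu> m c \<E> (y \<tau> $ 1) \<noteq> 0
           \<and> L_vec \<mu> (y \<tau>) (S \<tau>) \<noteq> 0)
        \<longrightarrow>
        (\<forall>\<tau>\<in>I. let r = y \<tau> $ 1 in
           N_fun \<mu> m c \<E> r \<ge> 0 \<and>
           (\<exists>s\<in>{1, -1}.
              P_r \<mu> (y \<tau>) (p \<tau>) =
                s * (m * sqrt (N_fun \<mu> m c \<E> r) / (schw_a \<mu> r * (m\<^sup>2 * r^3 - \<mu> * c\<^sup>2))) \<and>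
              ((\<lambda>\<sigma>. y \<sigma> $ 1) has_real_derivative
                s * (sqrt (N_fun \<mu> m c \<E> r) / eta_fun \<mu> m c \<E> r)) (at \<tau>))) \<and>
        (\<exists>\<kappa>. \<forall>\<tau>\<in>I. K_fun \<mu> (y \<tau>) (S \<tau>) = \<kappa>) \<and>
        (\<forall>\<kappa>. (\<forall>\<tau>\<in>I. K_fun \<mu> (y \<tau>) (S \<tau>) = \<kappa>) \<and> \<bar>\<kappa>\<bar> < 1 \<longrightarrow>
          (\<forall>\<tau>\<in>I. let r = y \<tau> $ 1; \<theta> = y \<tau> $ 2; L3 = L_vec \<mu> (y \<tau>) (S \<tau>) $ 3 in
             \<kappa>\<^sup>2 / (sin \<theta>)\<^sup>2 \<le> 1 \<and>
             (\<exists>s\<in>{1, -1}. (L3 > 0 \<longrightarrow> s = 1) \<and> (L3 < 0 \<longrightarrow> s = -1) \<and>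
                ((\<lambda>\<sigma>. y \<sigma> $ 2) has_real_derivative
                  s * (Phi_fun \<mu> m c \<E> r / eta_fun \<mu> m c \<E> r * sqrt (1 - \<kappa>\<^sup>2 / (sin \<theta>)\<^sup>2))) (at \<tau>)) \<and>
             ((\<lambda>\<sigma>. y \<sigma> $ 3) has_real_derivative
                - (\<kappa> * Phi_fun \<mu> m c \<E> r / (eta_fun \<mu> m c \<E> r * (sin \<theta>)\<^sup>2))) (at \<tau>) \<and>
             ((\<lambda>\<sigma>. y \<sigma> $ 0) has_real_derivative
                m * r^3 * \<E> / (schw_a \<mu> r * eta_fun \<mu> m c \<E> r)) (at \<tau>))))"
proof -
  interpret M: vanishing_Q_motion \<mu> m c I y p S
    by (rule vanishing_Q_motion.intro[OF assms(1-12,14)])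
  show ?thesis
  proof (intro conjI allI impI)
    show "\<forall>\<tau>\<in>I. P_theta \<mu> (y \<tau>) (p \<tau>) (S \<tau>) = 0 \<and> L_vec \<mu> (y \<tau>) (S \<tau>) $ 1 = 0
        \<and> P_phi \<mu> (y \<tau>) (p \<tau>) (S \<tau>) = 0"
      using total_angular_momentum_eq_0D[OF Q_zero off_axis] by blast
    show "\<exists>\<kappa>. \<forall>\<tau>\<in>I. K_fun \<mu> (y \<tau>) (S \<tau>) = \<kappa>"
      by (rule M.K_constant)
  next
    fix \<E> :: real
    assume "\<forall>\<tau>\<in>I. \<E> = - P_t \<mu> (y \<tau>) (p \<tau>) (S \<tau>)
           \<and> \<E> * (m\<^sup>2 * (y \<tau> $ 1)^3 - \<mu> * c\<^sup>2) > 0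
           \<and> eta_fun \<mu> m c \<E> (y \<tau> $ 1) \<noteq> 0
           \<and> L_vec \<mu> (y \<tau>) (S \<tau>) \<noteq> 0"
    then have E: "\<And>\<tau>. \<tau> \<in> I \<Longrightarrow> \<E> = - P_t \<mu> (y \<tau>) (p \<tau>) (S \<tau>)"
      "\<And>\<tau>. \<tau> \<in> I \<Longrightarrow> \<E> * (m\<^sup>2 * (y \<tau> $ 1)^3 - \<mu> * c\<^sup>2) > 0"
      "\<And>\<tau>. \<tau> \<in> I \<Longrightarrow> eta_fun \<mu> m c \<E> (y \<tau> $ 1) \<noteq> 0"
      by blast+
    \<comment> \<open>These equations lead from the functions of the locale back to the coordinates
      in which the claim is phrased.\<close>
    note defs = M.r_def M.a_def M.sn_def M.u0_def M.u1_def M.v2_def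
    show "\<forall>\<tau>\<in>I. let r = y \<tau> $ 1 in
           N_fun \<mu> m c \<E> r \<ge> 0 \<and>
           (\<exists>s\<in>{1, -1}.
              P_r \<mu> (y \<tau>) (p \<tau>) =
                s * (m * sqrt (N_fun \<mu> m c \<E> r) / (schw_a \<mu> r * (m\<^sup>2 * r^3 - \<mu> * c\<^sup>2))) \<and>
              ((\<lambda>\<sigma>. y \<sigma> $ 1) has_real_derivative
                s * (sqrt (N_fun \<mu> m c \<E> r) / eta_fun \<mu> m c \<E> r)) (at \<tau>))"
      unfolding Let_def
    proof (intro ballI conjI)
      fix \<tau> assume \<tau>: "\<tau> \<in> I"
      show "N_fun \<mu> m c \<E> (y \<tau> $ 1) \<ge> 0"
        using M.N_nonneg[OF E \<tau>] unfolding defs .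
      obtain s where s: "s \<in> {1, - 1}"
        "P_r \<mu> (y \<tau>) (p \<tau>) = s * (m * sqrt (N_fun \<mu> m c \<E> (y \<tau> $ 1)) /
          (schw_a \<mu> (y \<tau> $ 1) * (m\<^sup>2 * (y \<tau> $ 1)^3 - \<mu> * c\<^sup>2)))"
        "velocity y \<tau> $ 1 = s * (sqrt (N_fun \<mu> m c \<E> (y \<tau> $ 1)) / eta_fun \<mu> m c \<E> (y \<tau> $ 1))"
        using M.radial_quadrature[OF E \<tau>] unfolding defs by blast
      show "\<exists>s\<in>{1, -1}.
              P_r \<mu> (y \<tau>) (p \<tau>) = s * (m * sqrt (N_fun \<mu> m c \<E> (y \<tau> $ 1)) /
                (schw_a \<mu> (y \<tau> $ 1) * (m\<^sup>2 * (y \<tau> $ 1)^3 - \<mu> * c\<^sup>2))) \<and>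
              ((\<lambda>\<sigma>. y \<sigma> $ 1) has_real_derivative
                s * (sqrt (N_fun \<mu> m c \<E> (y \<tau> $ 1)) / eta_fun \<mu> m c \<E> (y \<tau> $ 1))) (at \<tau>)"
        using s M.DERIV_y[OF \<tau>, of 1] by metis
    qed
    fix \<kappa> :: real
    assume \<kappa>: "(\<forall>\<tau>\<in>I. K_fun \<mu> (y \<tau>) (S \<tau>) = \<kappa>) \<and> \<bar>\<kappa>\<bar> < 1"
    show "\<forall>\<tau>\<in>I. let r = y \<tau> $ 1; \<theta> = y \<tau> $ 2; L3 = L_vec \<mu> (y \<tau>) (S \<tau>) $ 3 in
             \<kappa>\<^sup>2 / (sin \<theta>)\<^sup>2 \<le> 1 \<and>
             (\<exists>s\<in>{1, -1}. (L3 > 0 \<longrightarrow> s = 1) \<and> (L3 < 0 \<longrightarrow> s = -1) \<and>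
                ((\<lambda>\<sigma>. y \<sigma> $ 2) has_real_derivative
                  s * (Phi_fun \<mu> m c \<E> r / eta_fun \<mu> m c \<E> r * sqrt (1 - \<kappa>\<^sup>2 / (sin \<theta>)\<^sup>2))) (at \<tau>)) \<and>
             ((\<lambda>\<sigma>. y \<sigma> $ 3) has_real_derivative
                - (\<kappa> * Phi_fun \<mu> m c \<E> r / (eta_fun \<mu> m c \<E> r * (sin \<theta>)\<^sup>2))) (at \<tau>) \<and>
             ((\<lambda>\<sigma>. y \<sigma> $ 0) has_real_derivative
                m * r^3 * \<E> / (schw_a \<mu> r * eta_fun \<mu> m c \<E> r)) (at \<tau>)"
      unfolding Let_def
    proof (rule ballI)
      fix \<tau> assume \<tau>: "\<tau> \<in> I"
      then have K: "K_fun \<mu> (y \<tau>) (S \<tau>) = \<kappa>" using \<kappa> by blast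
      note polar = M.polar_quadrature[OF E \<tau> K, unfolded defs]
      note azimuth = M.azimuth_quadrature[OF E \<tau> K, unfolded defs]
      note time = M.time_quadrature[OF E \<tau>, unfolded defs]
      note dy = M.DERIV_y[OF \<tau>]
      show "\<kappa>\<^sup>2 / (sin (y \<tau> $ 2))\<^sup>2 \<le> 1 \<and>
             (\<exists>s\<in>{1, -1}. (L_vec \<mu> (y \<tau>) (S \<tau>) $ 3 > 0 \<longrightarrow> s = 1) \<and>
                (L_vec \<mu> (y \<tau>) (S \<tau>) $ 3 < 0 \<longrightarrow> s = -1) \<and>
                ((\<lambda>\<sigma>. y \<sigma> $ 2) has_real_derivative
                  s * (Phi_fun \<mu> m c \<E> (y \<tau> $ 1) / eta_fun \<mu> m c \<E> (y \<tau> $ 1) *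
                    sqrt (1 - \<kappa>\<^sup>2 / (sin (y \<tau> $ 2))\<^sup>2))) (at \<tau>)) \<and>
             ((\<lambda>\<sigma>. y \<sigma> $ 3) has_real_derivative
                - (\<kappa> * Phi_fun \<mu> m c \<E> (y \<tau> $ 1) /
                  (eta_fun \<mu> m c \<E> (y \<tau> $ 1) * (sin (y \<tau> $ 2))\<^sup>2))) (at \<tau>) \<and>
             ((\<lambda>\<sigma>. y \<sigma> $ 0) has_real_derivative
                m * (y \<tau> $ 1)^3 * \<E> / (schw_a \<mu> (y \<tau> $ 1) * eta_fun \<mu> m c \<E> (y \<tau> $ 1))) (at \<tau>)"
      proof -
        from polar(2) obtain s :: real where s: "s \<in> {1, - 1}"
          "(L_vec \<mu> (y \<tau>) (S \<tau>) $ 3 > 0 \<longrightarrow> s = 1) \<and> (L_vec \<mu> (y \<tau>) (S \<tau>) $ 3 < 0 \<longrightarrow> s = - 1)"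
          "velocity y \<tau> $ 2 = s * (Phi_fun \<mu> m c \<E> (y \<tau> $ 1) / eta_fun \<mu> m c \<E> (y \<tau> $ 1) *
            sqrt (1 - \<kappa>\<^sup>2 / (sin (y \<tau> $ 2))\<^sup>2))"
          by blast
        show ?thesis
          by (intro conjI bexI[OF _ s(1)] polar(1) conjunct1[OF s(2)] conjunct2[OF s(2)]
              DERIV_cong[OF dy s(3)] DERIV_cong[OF dy azimuth] DERIV_cong[OF dy time])
      qed
    qed
  qed
qed

end
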